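(* Suppose (A1) the problem assumptions, (A2) the block/delay assumptions, (A3) the stepsize assumptions, and (A4) the error assumptions, all given in the context, hold. If the Algorithm described in the context terminates (i.e. executes its "return" instruction), then its final iterate $(z^{k+1},w_1^{k+1},\dots,w_{n-1}^{k+1})$ is a member of $\mathcal{S}$. Otherwise, the sequence $\{(z^k,\mathbf{w}^k)\}$ with $\mathbf{w}^k=(w_1^k,\dots,w_{n-1}^k)$ generated by the Algorithm converges weakly to some point $(\bar z,\overline{\mathbf{w}})=(\bar z,\overline w_1,\dots,\overline w_{n-1})\in\mathcal{S}$. Furthermore, in this case $x_i^k\rightharpoonup G_i\bar z$ and $y_i^k\rightharpoonup\overline w_i$ for all $i=1,\dots,n-1$, $x_n^k\rightharpoonup\bar z$, and $y_n^k\rightharpoonup-\sum_{i=1}^{n-1}G_i^*\overline w_i$.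
   Context: **(A1) Problem.** $n\ge 1$; $\mathcal{H}_0=\mathcal{H}_n$ and $\mathcal{H}_1,\dots,\mathcal{H}_{n-1}$ are real Hilbert spaces; $\boldsymbol{\mathcal{H}}=\mathcal{H}_0\times\mathcal{H}_1\times\cdots\times\mathcal{H}_{n-1}$. For $i=1,\dots,n$ the (set-valued) operator $T_i:\mathcal{H}_i\to 2^{\mathcal{H}_i}$ is monotone. $\{1,\dots,n\}$ is the disjoint union of $\mathcal{I}_{\mathrm F}$ and $\mathcal{I}_{\mathrm B}$: for $i\in\mathcal{I}_{\mathrm F}$, $T_i$ is single-valued with domain $\mathcal{H}_i$ and $L_i$-Lipschitz continuous, $L_i\ge 0$; for $i\in\mathcal{I}_{\mathrm B}$, $T_i$ is maximal monotone. $G_i:\mathcal{H}_0\to\mathcal{H}_i$, $i=1,\dots,n-1$, are bounded linear, and $G_n=I$ (identity). The Kuhn–Tucker set $$\mathcal{S}=\Big\{(z,w_1,\dots,w_{n-1})\in\boldsymbol{\mathcal{H}}: w_i\in T_i(G_iz),\ i=1,\dots,n-1,\ -\sum_{i=1}^{n-1}G_i^*w_i\in T_n(z)\Big\}$$ is nonempty. (Empty sums are $0$. The problem is $0\in\sum_{i=1}^{n-1}G_i^*T_i(G_iz)+T_n(z)$.) For maximal monotone $A$ and $\rho>0$, $\mathrm{prox}_{\rho A}=(I+\rho A)^{-1}$, which is single-valued and everywhere defined. **Algorithm.** Inputs: $(z^1,\mathbf{w}^1)\in\boldsymbol{\mathcal{H}}$ and $(x_i^0,y_i^0)\in\mathcal{H}_i^2$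 for $i=1,\dots,n$ (arbitrary). Parameters: sets $I_k\subseteq\{1,\dots,n\}$ for $k\ge1$; indices $d(i,k)\in\{1,\dots,k\}$; scalars $\rho_i^k>0$; constants $0<\underline\beta\le\overline\beta<2$ and $\beta_k\in[\underline\beta,\overline\beta]$; $\gamma>0$; errors $e_i^k\in\mathcal{H}_i$ for $i\in\mathcal{I}_{\mathrm B}$. Set $w_n^k=-\sum_{i=1}^{n-1}G_i^*w_i^k$ for all $k$. For $k=1,2,\dots$: 1. For $i\in I_k\cap\mathcal{I}_{\mathrm B}$: $a=G_iz^{d(i,k)}+\rho_i^{d(i,k)}w_i^{d(i,k)}+e_i^k$, $x_i^k=\mathrm{prox}_{\rho_i^{d(i,k)}T_i}(a)$, $y_i^k=(\rho_i^{d(i,k)})^{-1}(a-x_i^k)$. 2. For $i\in I_k\cap\mathcal{I}_{\mathrm F}$: $x_i^k=G_iz^{d(i,k)}-\rho_i^{d(i,k)}\big(T_iG_iz^{d(i,k)}-w_i^{d(i,k)}\big)$, $y_i^k=T_ix_i^k$. 3. For $i\notin I_k$: $(x_i^k,y_i^k)=(x_i^{k-1},y_i^{k-1})$. 4. $u_i^k=x_i^k-G_ix_n^k$ ($i=1,\dots,n-1$), $v^k=\sum_{i=1}^{n-1}G_i^*y_i^k+y_n^k$, $\pi_k=\sum_{i=1}^{n-1}\|u_i^k\|^2+\gamma^{-1}\|v^k\|^2$. 5. If $\pi_k>0$: $\varphi_k(p^k)=\langle z^k,v^k\rangle+\sum_{i=1}^{n-1}\langle w_i^k,u_i^k\rangle-\sum_{i=1}^n\langle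 x_i^k,y_i^k\rangle$ and $\alpha_k=\frac{\beta_k}{\pi_k}\max\{0,\varphi_k(p^k)\}$. If $\pi_k=0$: if $\bigcup_{j=1}^kI_j=\{1,\dots,n\}$, return (terminate) with $z^{k+1}=x_n^k$, $w_i^{k+1}=y_i^k$ for $i=1,\dots,n-1$; else $\alpha_k=0$. 6. $z^{k+1}=z^k-\gamma^{-1}\alpha_kv^k$, $w_i^{k+1}=w_i^k-\alpha_ku_i^k$ ($i=1,\dots,n-1$), $w_n^{k+1}=-\sum_{i=1}^{n-1}G_i^*w_i^{k+1}$. **(A2)** (1) For some integer $M\ge1$, $\bigcup_{k=j}^{j+M-1}I_k=\{1,\dots,n\}$ for all $j\ge1$. (2) For some integer $D\ge0$, $k-d(i,k)\le D$ for all $i,k$ with $i\in I_k$. **(A3)** $\underline\rho=\min_{i=1,\dots,n}\inf_{k\ge1}\rho_i^k>0$; $\overline\rho=\max_{i\in\mathcal{I}_{\mathrm B}}\sup_{k\ge1}\rho_i^k<\infty$; for all $i\in\mathcal{I}_{\mathrm F}$, $\overline\rho_i=\limsup_{k\to\infty}\rho_i^k<1/L_i$ (with $1/0=+\infty$). **(A4)** Let $s(i,k)$ be the largest $j\le k$ with $i\in I_j$ ($s(i,k)=0$ if there is none), and $l(i,k)=d(i,s(i,k))$, with $d(i,0)=0$. The sequences $\{e_i^k\}_k$, $i\in\mathcal{I}_{\mathrm B}$, are bounded, and for some $\sigma\in[0,1)$, for all $i\in\mathcal{I}_{\mathrm B}$ and all $k\ge1$ with $s(i,k)\ge1$: $\langle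 G_iz^{l(i,k)}-x_i^k,e_i^{s(i,k)}\rangle\ge-\sigma\|G_iz^{l(i,k)}-x_i^k\|^2$ and $\langle e_i^{s(i,k)},y_i^k-w_i^{l(i,k)}\rangle\le\rho_i^{l(i,k)}\sigma\|y_i^k-w_i^{l(i,k)}\|^2$. *)

theory Defs
  imports "HOL-Analysis.Analysis"
begin

text \<open>
  A finite family of real Hilbert spaces \<open>H 0, H 1, ...\<close> whose number is a variable cannot be
  given by a family of types. The members are therefore complete linear subspaces of one real inner
  product space \<open>'a\<close>, which need not be complete itself. This is no restriction: any finite family
  of Hilbert spaces embeds isometrically into its direct sum. The subspaces are not assumed to be
  related to each other, and operators are constrained only on these carriers.
\<close>

definition hilbert_subspace :: "'a::real_inner set \<Rightarrow> bool" where
  "hilbert_subspace H \<longleftrightarrow> subspace H \<and> complete H"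

definition bounded_linear_between ::
    "'a::real_inner set \<Rightarrow> 'a set \<Rightarrow> ('a \<Rightarrow> 'a) \<Rightarrow> bool" where
  "bounded_linear_between H K f \<longleftrightarrow>
     f \<in> H \<rightarrow> K \<and>
     (\<forall>x\<in>H. \<forall>y\<in>H. f (x + y) = f x + f y) \<and>
     (\<forall>c. \<forall>x\<in>H. f (c *\<^sub>R x) = c *\<^sub>R f x) \<and>
     (\<exists>B. \<forall>x\<in>H. norm (f x) \<le> B * norm x)"

text \<open>
  The adjoint of an operator with domain \<open>H\<close>; for a Hilbert space \<open>H\<close> and a bounded linear \<open>f\<close>,
  the described element exists by the Riesz representation theorem. The library constant
  \<^const>\<open>adjoint\<close> applies only to operators that are defined on a whole type.
\<close>

definition adjoint_on :: "'a::real_inner set \<Rightarrow> ('a \<Rightarrow> 'a) \<Rightarrow> 'a \<Rightarrow> 'a" where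
  "adjoint_on H f y = (THE x. x \<in> H \<and> (\<forall>h\<in>H. inner (f h) y = inner h x))"

definition monotone_operator :: "'a::real_inner set \<Rightarrow> ('a \<Rightarrow> 'a set) \<Rightarrow> bool" where
  "monotone_operator H T \<longleftrightarrow>
     (\<forall>x\<in>H. T x \<subseteq> H) \<and>
     (\<forall>x\<in>H. \<forall>x'\<in>H. \<forall>u\<in>T x. \<forall>u'\<in>T x'. inner (x - x') (u - u') \<ge> 0)"

definition maximal_monotone_operator :: "'a::real_inner set \<Rightarrow> ('a \<Rightarrow> 'a set) \<Rightarrow> bool" where
  "maximal_monotone_operator H T \<longleftrightarrow>
     monotone_operator H T \<and>
     (\<forall>S. monotone_operator H S \<and> (\<forall>x\<in>H. T x \<subseteq> S x) \<longrightarrow> (\<forall>x\<in>H. S x = T x))"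

text \<open>
  The inverse of \<open>I + \<rho>A\<close> as a set-valued operator. For maximal monotone \<open>A\<close> on a Hilbert space
  and \<open>\<rho> > 0\<close> its values are singletons (Minty), so that \<open>x \<in> prox H \<rho> A a\<close> is what is
  usually written as an equation.
\<close>

definition prox :: "'a::real_inner set \<Rightarrow> real \<Rightarrow> ('a \<Rightarrow> 'a set) \<Rightarrow> 'a \<Rightarrow> 'a set" where
  "prox H \<rho> A a = {x \<in> H. a \<in> {x + \<rho> *\<^sub>R u | u. u \<in> A x}}"

text \<open>
  Points \<open>(z, w\<^sub>1, ..., w\<^bsub>n-1\<^esub>)\<close> of \<open>H 0 \<times> H 1 \<times> ... \<times> H (n - 1)\<close> are pairs \<open>(z, w)\<close> with
  \<open>w :: nat \<Rightarrow> 'a\<close>; the values of \<open>w\<close> outside \<open>{1..<n}\<close> carry no information.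
\<close>

definition product_space :: "nat \<Rightarrow> (nat \<Rightarrow> 'a::real_inner set) \<Rightarrow> ('a \<times> (nat \<Rightarrow> 'a)) set" where
  "product_space n H = H 0 \<times> Pi {1..<n} H"

definition product_inner ::
    "nat \<Rightarrow> 'a::real_inner \<times> (nat \<Rightarrow> 'a) \<Rightarrow> 'a \<times> (nat \<Rightarrow> 'a) \<Rightarrow> real" where
  "product_inner n p q = inner (fst p) (fst q) + (\<Sum>i\<in>{1..<n}. inner (snd p i) (snd q i))"

text \<open>Weak convergence in the Hilbert space with carrier \<open>C\<close> and inner product \<open>ip\<close>.\<close>

definition weakly_converges ::
    "'b set \<Rightarrow> ('b \<Rightarrow> 'b \<Rightarrow> real) \<Rightarrow> (nat \<Rightarrow> 'b) \<Rightarrow> 'b \<Rightarrow> bool" where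
  "weakly_converges C ip X l \<longleftrightarrow>
     l \<in> C \<and> (\<forall>h\<in>C. (\<lambda>k. ip (X k) h) \<longlonglongrightarrow> ip l h)"

definition kt_set ::
    "nat \<Rightarrow> (nat \<Rightarrow> 'a::real_inner set) \<Rightarrow> (nat \<Rightarrow> 'a \<Rightarrow> 'a set) \<Rightarrow> (nat \<Rightarrow> 'a \<Rightarrow> 'a) \<Rightarrow>
     ('a \<times> (nat \<Rightarrow> 'a)) set" where
  "kt_set n H T G = {(z, w) \<in> product_space n H.
     (\<forall>i\<in>{1..<n}. w i \<in> T i (G i z)) \<and>
     - (\<Sum>i\<in>{1..<n}. adjoint_on (H 0) (G i) (w i)) \<in> T n z}"

text \<open>
  In all iterates the block index \<open>i\<close> comes first and the iteration counter \<open>k\<close> second.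
\<close>

definition resid_u :: "nat \<Rightarrow> (nat \<Rightarrow> 'a \<Rightarrow> 'a) \<Rightarrow> (nat \<Rightarrow> nat \<Rightarrow> 'a::real_inner) \<Rightarrow>
    nat \<Rightarrow> nat \<Rightarrow> 'a" where
  "resid_u n G x i k = x i k - G i (x n k)"

definition resid_v :: "nat \<Rightarrow> (nat \<Rightarrow> 'a set) \<Rightarrow> (nat \<Rightarrow> 'a \<Rightarrow> 'a) \<Rightarrow>
    (nat \<Rightarrow> nat \<Rightarrow> 'a::real_inner) \<Rightarrow> nat \<Rightarrow> 'a" where
  "resid_v n H G y k = (\<Sum>i\<in>{1..<n}. adjoint_on (H 0) (G i) (y i k)) + y n k"

definition grad_norm2 :: "nat \<Rightarrow> (nat \<Rightarrow> 'a set) \<Rightarrow> (nat \<Rightarrow> 'a \<Rightarrow> 'a) \<Rightarrow> real \<Rightarrow>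
    (nat \<Rightarrow> nat \<Rightarrow> 'a::real_inner) \<Rightarrow> (nat \<Rightarrow> nat \<Rightarrow> 'a) \<Rightarrow> nat \<Rightarrow> real" where
  "grad_norm2 n H G \<gamma> x y k =
     (\<Sum>i\<in>{1..<n}. (norm (resid_u n G x i k))\<^sup>2) + inverse \<gamma> * (norm (resid_v n H G y k))\<^sup>2"

definition separator :: "nat \<Rightarrow> (nat \<Rightarrow> 'a set) \<Rightarrow> (nat \<Rightarrow> 'a \<Rightarrow> 'a) \<Rightarrow>
    (nat \<Rightarrow> 'a::real_inner) \<Rightarrow> (nat \<Rightarrow> nat \<Rightarrow> 'a) \<Rightarrow>
    (nat \<Rightarrow> nat \<Rightarrow> 'a) \<Rightarrow> (nat \<Rightarrow> nat \<Rightarrow> 'a) \<Rightarrow> nat \<Rightarrow> real" where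
  "separator n H G z w x y k =
     inner (z k) (resid_v n H G y k)
     + (\<Sum>i\<in>{1..<n}. inner (w i k) (resid_u n G x i k))
     - (\<Sum>i\<in>{1..n}. inner (x i k) (y i k))"

definition step_alpha :: "nat \<Rightarrow> (nat \<Rightarrow> 'a set) \<Rightarrow> (nat \<Rightarrow> 'a \<Rightarrow> 'a) \<Rightarrow> (nat \<Rightarrow> real) \<Rightarrow> real \<Rightarrow>
    (nat \<Rightarrow> 'a::real_inner) \<Rightarrow> (nat \<Rightarrow> nat \<Rightarrow> 'a) \<Rightarrow>
    (nat \<Rightarrow> nat \<Rightarrow> 'a) \<Rightarrow> (nat \<Rightarrow> nat \<Rightarrow> 'a) \<Rightarrow> nat \<Rightarrow> real" where
  "step_alpha n H G \<beta> \<gamma> z w x y k =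
     (if grad_norm2 n H G \<gamma> x y k > 0
      then \<beta> k / grad_norm2 n H G \<gamma> x y k * max 0 (separator n H G z w x y k)
      else 0)"

definition return_test :: "nat \<Rightarrow> (nat \<Rightarrow> 'a set) \<Rightarrow> (nat \<Rightarrow> 'a \<Rightarrow> 'a) \<Rightarrow> (nat \<Rightarrow> nat set) \<Rightarrow> real \<Rightarrow>
    (nat \<Rightarrow> nat \<Rightarrow> 'a::real_inner) \<Rightarrow> (nat \<Rightarrow> nat \<Rightarrow> 'a) \<Rightarrow> nat \<Rightarrow> bool" where
  "return_test n H G I \<gamma> x y k \<longleftrightarrow>
     grad_norm2 n H G \<gamma> x y k = 0 \<and> (\<Union>j\<in>{1..k}. I j) = {1..n}"

text \<open>Iteration \<open>k\<close> is carried out iff no earlier iteration returned.\<close>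

definition executed :: "nat \<Rightarrow> (nat \<Rightarrow> 'a set) \<Rightarrow> (nat \<Rightarrow> 'a \<Rightarrow> 'a) \<Rightarrow> (nat \<Rightarrow> nat set) \<Rightarrow> real \<Rightarrow>
    (nat \<Rightarrow> nat \<Rightarrow> 'a::real_inner) \<Rightarrow> (nat \<Rightarrow> nat \<Rightarrow> 'a) \<Rightarrow> nat \<Rightarrow> bool" where
  "executed n H G I \<gamma> x y k \<longleftrightarrow> 1 \<le> k \<and> (\<forall>j\<in>{1..<k}. \<not> return_test n H G I \<gamma> x y j)"

definition terminates_at :: "nat \<Rightarrow> (nat \<Rightarrow> 'a set) \<Rightarrow> (nat \<Rightarrow> 'a \<Rightarrow> 'a) \<Rightarrow> (nat \<Rightarrow> nat set) \<Rightarrow> real \<Rightarrow>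
    (nat \<Rightarrow> nat \<Rightarrow> 'a::real_inner) \<Rightarrow> (nat \<Rightarrow> nat \<Rightarrow> 'a) \<Rightarrow> nat \<Rightarrow> bool" where
  "terminates_at n H G I \<gamma> x y k \<longleftrightarrow>
     executed n H G I \<gamma> x y k \<and> return_test n H G I \<gamma> x y k"

text \<open>
  \<open>z, w, x, y\<close> are the iterates of a run of the algorithm. Nothing is required of the values of
  these sequences beyond the iterates that the run produces before or upon termination.
  For \<open>i \<in> IF\<close> the values of \<open>T i\<close> are singletons, and \<^const>\<open>the_elem\<close> extracts their element.
\<close>

definition projective_splitting_run ::
    "nat \<Rightarrow> (nat \<Rightarrow> 'a::real_inner set) \<Rightarrow> (nat \<Rightarrow> 'a \<Rightarrow> 'a set) \<Rightarrow> (nat \<Rightarrow> 'a \<Rightarrow> 'a) \<Rightarrow>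
     nat set \<Rightarrow> nat set \<Rightarrow> (nat \<Rightarrow> nat set) \<Rightarrow> (nat \<Rightarrow> nat \<Rightarrow> nat) \<Rightarrow>
     (nat \<Rightarrow> nat \<Rightarrow> real) \<Rightarrow> (nat \<Rightarrow> real) \<Rightarrow> real \<Rightarrow> (nat \<Rightarrow> nat \<Rightarrow> 'a) \<Rightarrow>
     (nat \<Rightarrow> 'a) \<Rightarrow> (nat \<Rightarrow> nat \<Rightarrow> 'a) \<Rightarrow> (nat \<Rightarrow> nat \<Rightarrow> 'a) \<Rightarrow> (nat \<Rightarrow> nat \<Rightarrow> 'a) \<Rightarrow> bool" where
  "projective_splitting_run n H T G IF IB I d \<rho> \<beta> \<gamma> e z w x y \<longleftrightarrow>
     (z 1, \<lambda>i. w i 1) \<in> product_space n H \<and>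
     (\<forall>i\<in>{1..n}. x i 0 \<in> H i \<and> y i 0 \<in> H i) \<and>
     (\<forall>k. executed n H G I \<gamma> x y k \<longrightarrow>
        w n k = - (\<Sum>i\<in>{1..<n}. adjoint_on (H 0) (G i) (w i k)) \<and>
        (\<forall>i\<in>I k \<inter> IB.
           let \<delta> = d i k; a = G i (z \<delta>) + \<rho> i \<delta> *\<^sub>R w i \<delta> + e i k
           in x i k \<in> prox (H i) (\<rho> i \<delta>) (T i) a \<and> y i k = inverse (\<rho> i \<delta>) *\<^sub>R (a - x i k)) \<and>
        (\<forall>i\<in>I k \<inter> IF.
           let \<delta> = d i k
           in x i k = G i (z \<delta>) - \<rho> i \<delta> *\<^sub>R (the_elem (T i (G i (z \<delta>))) - w i \<delta>) \<and>
              y i k = the_elem (T i (x i k))) \<and>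
        (\<forall>i\<in>{1..n} - I k. x i k = x i (k - 1) \<and> y i k = y i (k - 1)) \<and>
        (if return_test n H G I \<gamma> x y k then
           z (k + 1) = x n k \<and>
           (\<forall>i\<in>{1..<n}. w i (k + 1) = y i k)
         else
           z (k + 1) = z k - (inverse \<gamma> * step_alpha n H G \<beta> \<gamma> z w x y k) *\<^sub>R resid_v n H G y k \<and>
           (\<forall>i\<in>{1..<n}.
              w i (k + 1) = w i k - step_alpha n H G \<beta> \<gamma> z w x y k *\<^sub>R resid_u n G x i k)))"

text \<open>
  The most recent iteration up to \<open>k\<close> that processed block \<open>i\<close> (\<open>0\<close> if there is none), and the
  iteration whose \<open>z\<close> and \<open>w i\<close> were used there.
\<close>

definition last_activation :: "(nat \<Rightarrow> nat set) \<Rightarrow> nat \<Rightarrow> nat \<Rightarrow> nat" where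
  "last_activation I i k = Max (insert 0 {j \<in> {1..k}. i \<in> I j})"

definition last_info :: "(nat \<Rightarrow> nat set) \<Rightarrow> (nat \<Rightarrow> nat \<Rightarrow> nat) \<Rightarrow> nat \<Rightarrow> nat \<Rightarrow> nat" where
  "last_info I d i k = (let s = last_activation I i k in if s = 0 then 0 else d i s)"

end

theory Submission
  imports Defs
begin

text \<open>
  Every iteration projects the current point onto a half-space that contains the Kuhn-Tucker set, so
  the iterates are Fejer monotone in the norm weighted by \<open>\<gamma>\<close>, their increments vanish, and
  \<open>max 0 (\<phi>\<^sub>k(p\<^sup>k))\<close> tends to \<open>0\<close>. Up to a vanishing error caused by the bounded delays,
  \<open>\<phi>\<^sub>k(p\<^sup>k)\<close> is the sum of the terms \<open>\<langle>G\<^sub>i z - x\<^sub>i, y\<^sub>i - w\<^sub>i\<rangle>\<close> with \<open>z\<close> and \<open>w\<^sub>i\<close> taken at the time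
  from which block \<open>i\<close> was last processed. The stepsize and error conditions make each term dominate
  a multiple of the squared norms of both of its factors, so \<open>x\<^sub>i - G\<^sub>i z\<close> and \<open>y\<^sub>i - w\<^sub>i\<close> tend to
  \<open>0\<close> strongly. Maximal monotonicity then puts every weak cluster point into the Kuhn-Tucker set, and
  Opial's argument yields weak convergence.
\<close>

section \<open>Riesz representation and adjoints on complete subspaces\<close>

text \<open>Weak convergence of \<open>x i\<close> and \<open>y i\<close> says nothing about the
  limit of \<open>inner (x i k) (y i k)\<close>, so the graph inequalities cannot be passed to the
  limit block by block. Orthogonality rescues the argument: once minus the sum of the
  \<open>adj i (w i k)\<close> is adjoined as an n-th dual vector, the families
  \<open>G i (z k)\<close> and \<open>w i k\<close> are orthogonal in the sum over
  \<open>{1..n}\<close>. This turns the separator into a sum of block products, and it forces the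
  sum of the \<open>inner (x i k) (y i k)\<close> to \<open>0\<close> once the block residuals
  vanish strongly. Only that sum has a known limit, hence membership in the Kuhn-Tucker set is
  tested on sums. A second obstacle: the Fejer decrease controls only the quotient of the square of
  \<open>max 0 (\<phi> k)\<close> by \<open>\<pi> k\<close>, which says something about
  \<open>\<phi> k\<close> only if \<open>\<pi> k\<close> stays bounded. So \<open>x\<close> and
  \<open>y\<close> have to be bounded before any residual is known to vanish. For backward blocks
  this comes from monotonicity against a fixed solution, for forward blocks from the explicit step
  and the Lipschitz bound.\<close>

lemma inner_eq_on_imp_eq:
  assumes "subspace H" "x \<in> H" "y \<in> H" "\<And>h. h \<in> H \<Longrightarrow> inner h x = inner h y"
  shows "x = y"
proof -
  have "inner (x - y) (x - y) = inner (x - y) x - inner (x - y) y"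
    by (simp add: inner_diff_right)
  also have "\<dots> = 0"
    using assms by (simp add: subspace_diff)
  finally show ?thesis
    by simp
qed

text \<open>Variational proof: the representer is the minimiser over \<open>H\<close> of the squared
  norm minus twice \<open>f\<close>. Completeness supplies the minimiser, and its first-order
  condition is the representation formula.\<close>

lemma riesz_representation_on:
  fixes f :: "'a::real_inner \<Rightarrow> real"
  assumes H: "hilbert_subspace H"
    and add: "\<And>x y. x \<in> H \<Longrightarrow> y \<in> H \<Longrightarrow> f (x + y) = f x + f y"
    and scale: "\<And>c x. x \<in> H \<Longrightarrow> f (c *\<^sub>R x) = c * f x"
    and bound: "\<And>x. x \<in> H \<Longrightarrow> \<bar>f x\<bar> \<le> B * norm x"
  shows "\<exists>!x. x \<in> H \<and> (\<forall>h\<in>H. f h = inner h x)"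
proof -
  have sub: "subspace H" and compl: "complete H"
    using H by (auto simp: hilbert_subspace_def)
  define J where "J x = (norm x)\<^sup>2 - 2 * f x" for x
  have J_bound: "- B\<^sup>2 \<le> J x" if "x \<in> H" for x
  proof -
    have "0 \<le> (norm x - B)\<^sup>2" by simp
    then show ?thesis
      using bound[OF that] unfolding J_def power2_diff by (simp add: abs_le_iff algebra_simps)
  qed
  have bdd: "bdd_below (J ` H)"
    using J_bound by (auto intro: bdd_belowI2[where m = "- B\<^sup>2"])
  define m where "m = Inf (J ` H)"
  have m_le: "m \<le> J x" if "x \<in> H" for x
    unfolding m_def using bdd that by (auto intro: cInf_lower)
  have "0 \<in> H" using sub by (rule subspace_0)
  have "\<exists>x\<in>H. J x < m + inverse (real (Suc k))" for k
  proof -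
    have "Inf (J ` H) < m + inverse (real (Suc k))"
      by (simp add: m_def)
    then show ?thesis
      using cInf_lessD[of "J ` H"] \<open>0 \<in> H\<close> by blast
  qed
  then obtain X where X: "\<And>k. X k \<in> H" "\<And>k. J (X k) < m + inverse (real (Suc k))"
    by metis
  \<comment> \<open>The linear part of \<open>J\<close> averages exactly at the midpoint, so the
    parallelogram law for the norm carries over to \<open>J\<close>. As \<open>J\<close> is at least
    \<open>m\<close> at the midpoint, two near-minimisers are close to each other.\<close>
  have parallelogram: "(norm (x - y))\<^sup>2 \<le> 2 * (J x - m) + 2 * (J y - m)" if "x \<in> H" "y \<in> H" for x y
  proof -
    have "(1/2) *\<^sub>R (x + y) \<in> H"
      using sub that by (simp add: subspace_add subspace_scale)
    moreover have "(norm (x - y))\<^sup>2 = 2 * J x + 2 * J y - 4 * J ((1/2) *\<^sub>R (x + y))"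
    proof -
      have "f ((1/2) *\<^sub>R (x + y)) = (f x + f y) / 2"
        using that sub by (simp add: scale add subspace_add)
      moreover have "(norm ((1/2) *\<^sub>R (x + y)))\<^sup>2 = ((norm x)\<^sup>2 + 2 * inner x y + (norm y)\<^sup>2) / 4"
        unfolding power2_norm_eq_inner by (simp add: inner_add inner_commute)
      moreover have "(norm (x - y))\<^sup>2 = (norm x)\<^sup>2 - 2 * inner x y + (norm y)\<^sup>2"
        unfolding power2_norm_eq_inner by (simp add: inner_diff inner_commute)
      ultimately show ?thesis
        unfolding J_def by simp
    qed
    ultimately show ?thesis
      using m_le[of "(1/2) *\<^sub>R (x + y)"] by simp
  qed
  have "Cauchy X"
  proof (rule CauchyI)
    fix \<epsilon> :: real assume "0 < \<epsilon>"
    obtain N where N: "inverse (real (Suc N)) < \<epsilon>\<^sup>2 / 4"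
      using reals_Archimedean[of "\<epsilon>\<^sup>2 / 4"] \<open>0 < \<epsilon>\<close> by auto
    have "norm (X i - X j) < \<epsilon>" if "i \<ge> N" "j \<ge> N" for i j
    proof -
      have "inverse (real (Suc i)) \<le> inverse (real (Suc N))" "inverse (real (Suc j)) \<le> inverse (real (Suc N))"
        using that by auto
      then have "(norm (X i - X j))\<^sup>2 < \<epsilon>\<^sup>2"
        using parallelogram[of "X i" "X j"] X[of i] X[of j] N by argo
      then show ?thesis
        using \<open>0 < \<epsilon>\<close> by (simp add: power_less_imp_less_base)
    qed
    then show "\<exists>N. \<forall>m\<ge>N. \<forall>n\<ge>N. norm (X m - X n) < \<epsilon>" by blast
  qed
  then obtain x where x: "x \<in> H" "X \<longlonglongrightarrow> x"
    using compl X(1) unfolding complete_def by blast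
  have fdiff: "f (u - v) = f u - f v" if "u \<in> H" "v \<in> H" for u v
    using add[of "u - v" v] that sub by (simp add: subspace_diff)
  have "(\<lambda>k. f (X k)) \<longlonglongrightarrow> f x"
  proof -
    have "(\<lambda>k. B * norm (X k - x)) \<longlonglongrightarrow> B * norm (x - x)"
      by (intro tendsto_intros x(2))
    then have "(\<lambda>k. f (X k) - f x) \<longlonglongrightarrow> 0"
      by (intro Lim_null_comparison[of "\<lambda>k. f (X k) - f x" "\<lambda>k. B * norm (X k - x)"])
        (use X(1) x(1) bound sub in \<open>auto simp: fdiff[symmetric] subspace_diff\<close>)
    then show ?thesis
      by (simp add: LIM_zero_iff)
  qed
  then have "(\<lambda>k. J (X k)) \<longlonglongrightarrow> J x"
    unfolding J_def by (intro tendsto_intros x(2))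
  moreover have "(\<lambda>k. m + inverse (real (Suc k))) \<longlonglongrightarrow> m + 0"
    by (intro tendsto_intros LIMSEQ_inverse_real_of_nat)
  ultimately have "J x \<le> m"
    using X(2) by (intro LIMSEQ_le[of "\<lambda>k. J (X k)" _ "\<lambda>k. m + inverse (real (Suc k))"])
      (auto intro: less_imp_le)
  then have x_min: "J x \<le> J y" if "y \<in> H" for y
    using m_le[OF that] by simp
  have "f h = inner h x" if "h \<in> H" for h
  proof -
    define r where "r = inner h x - f h"
    have quad: "0 \<le> 2 * t * r + t\<^sup>2 * (norm h)\<^sup>2" for t
    proof -
      have "x + t *\<^sub>R h \<in> H"
        using sub x that by (simp add: subspace_add subspace_scale)
      moreover have "(norm (x + t *\<^sub>R h))\<^sup>2 = (norm x)\<^sup>2 + 2 * t * inner h x + t\<^sup>2 * (norm h)\<^sup>2"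
        unfolding power2_norm_eq_inner by (simp add: inner_add inner_commute power2_eq_square)
      moreover have "f (x + t *\<^sub>R h) = f x + t * f h"
        using x that sub by (simp add: add scale subspace_scale)
      ultimately show ?thesis
        using x_min[of "x + t *\<^sub>R h"] unfolding J_def r_def by (simp add: algebra_simps)
    qed
    have "r = 0"
    proof (cases "h = 0")
      case True
      then show ?thesis using quad[of 1] quad[of "-1"] by simp
    next
      case False
      \<comment> \<open>The chosen \<open>t\<close> minimises the quadratic in \<open>quad\<close>;
        the right-hand side is its minimal value.\<close>
      have "0 \<le> - (r\<^sup>2 / (norm h)\<^sup>2)"
        using quad[of "- r / (norm h)\<^sup>2"] False
        by (simp add: power2_eq_square field_simps)
      then have "r\<^sup>2 \<le> 0"
        using False by (simp add: divide_le_0_iff)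
      then show ?thesis by simp
    qed
    then show ?thesis by (simp add: r_def)
  qed
  with x(1) have "x \<in> H \<and> (\<forall>h\<in>H. f h = inner h x)" by blast
  moreover have "y = x" if "y \<in> H \<and> (\<forall>h\<in>H. f h = inner h y)" for y
    using inner_eq_on_imp_eq[OF sub, of y x] that calculation by auto
  ultimately show ?thesis by blast
qed

text \<open>For any \<open>y\<close> of the type, in \<open>K\<close> or not,
  \<open>inner (f h) y\<close> is a bounded functional of \<open>h\<close> in \<open>H\<close>, so
  Riesz applies. The adjoint is thus a total map and can be \<open>bounded_linear\<close> on the
  type, without side conditions on its argument.\<close>

lemma adjoint_on_props:
  assumes "hilbert_subspace H" "bounded_linear_between H K f"
  shows adjoint_on_mem: "adjoint_on H f y \<in> H"
    and inner_adjoint_on: "h \<in> H \<Longrightarrow> inner h (adjoint_on H f y) = inner (f h) y"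
proof -
  from assms obtain B where B: "\<And>x. x \<in> H \<Longrightarrow> norm (f x) \<le> B * norm x"
    and lin: "\<And>x y. x \<in> H \<Longrightarrow> y \<in> H \<Longrightarrow> f (x + y) = f x + f y"
      "\<And>c x. x \<in> H \<Longrightarrow> f (c *\<^sub>R x) = c *\<^sub>R f x"
    unfolding bounded_linear_between_def by blast
  have "\<exists>!x. x \<in> H \<and> (\<forall>h\<in>H. inner (f h) y = inner h x)"
  proof (rule riesz_representation_on[OF assms(1), where B = "B * norm y"])
    fix x assume "x \<in> H"
    have "\<bar>inner (f x) y\<bar> \<le> norm (f x) * norm y"
      by (rule Cauchy_Schwarz_ineq2)
    also have "\<dots> \<le> B * norm x * norm y"
      by (intro mult_right_mono B \<open>x \<in> H\<close>) simp
    finally show "\<bar>inner (f x) y\<bar> \<le> B * norm y * norm x"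
      by (simp add: mult_ac)
  qed (simp_all add: lin inner_add_left)
  from theI'[OF this]
  show "adjoint_on H f y \<in> H" and "h \<in> H \<Longrightarrow> inner h (adjoint_on H f y) = inner (f h) y"
    by (auto simp: adjoint_on_def)
qed

lemma adjoint_on_eqI:
  assumes "hilbert_subspace H" "bounded_linear_between H K f" "x \<in> H"
    and "\<And>h. h \<in> H \<Longrightarrow> inner h x = inner (f h) y"
  shows "adjoint_on H f y = x"
  by (rule inner_eq_on_imp_eq[of H])
    (use assms in \<open>auto simp: adjoint_on_props hilbert_subspace_def\<close>)

lemma bounded_linear_adjoint_on:
  assumes H: "hilbert_subspace H" and f: "bounded_linear_between H K f"
  shows "bounded_linear (adjoint_on H f)"
proof -
  note adj = adjoint_on_mem[OF H f] inner_adjoint_on[OF H f]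
  have sub: "subspace H" using H by (simp add: hilbert_subspace_def)
  obtain B0 where B0: "\<And>x. x \<in> H \<Longrightarrow> norm (f x) \<le> B0 * norm x"
    using f unfolding bounded_linear_between_def by blast
  \<comment> \<open>On a trivial \<open>H\<close> the constant \<open>B0\<close> may be negative;
    the absolute value keeps the bound valid when the adjoint vanishes at \<open>x\<close>.\<close>
  define B where "B = \<bar>B0\<bar>"
  have "B0 * norm x \<le> B * norm x" for x :: 'a
    unfolding B_def by (intro mult_right_mono) auto
  then have B: "norm (f x) \<le> B * norm x" if "x \<in> H" for x
    using B0[OF that] order_trans by blast
  show ?thesis
  proof (rule bounded_linear_intro[where K = B])
    fix x y and c :: real
    show "adjoint_on H f (x + y) = adjoint_on H f x + adjoint_on H f y"
      by (rule adjoint_on_eqI[OF H f]) (auto simp: adj sub subspace_add inner_add_right)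
    show "adjoint_on H f (c *\<^sub>R x) = c *\<^sub>R adjoint_on H f x"
      by (rule adjoint_on_eqI[OF H f]) (auto simp: adj sub subspace_scale)
    let ?a = "adjoint_on H f x"
    have "norm ?a * norm ?a = inner (f ?a) x"
      by (simp add: adj flip: power2_eq_square power2_norm_eq_inner inner_adjoint_on[OF H f])
    also have "\<dots> \<le> norm (f ?a) * norm x"
      by (rule norm_cauchy_schwarz)
    also have "\<dots> \<le> B * norm ?a * norm x"
      by (intro mult_right_mono B adj) simp
    finally show "norm ?a \<le> norm x * B"
      by (cases "?a = 0") (simp_all add: mult_ac B_def)
  qed
qed

lemma bounded_linear_between_ident: "bounded_linear_between H H (\<lambda>v. v)"
  unfolding bounded_linear_between_def by (auto intro: exI[of _ 1])

section \<open>Weak limits of bounded sequences\<close>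

lemma compact_function_box:
  fixes B :: "'i \<Rightarrow> real"
  shows "compact {g :: 'i \<Rightarrow> real. \<forall>t. \<bar>g t\<bar> \<le> B t}"
proof -
  have "{g :: 'i \<Rightarrow> real. \<forall>t. \<bar>g t\<bar> \<le> B t} = PiE UNIV (\<lambda>t. {- B t..B t})"
    by (auto simp: abs_le_iff PiE_def Pi_def; smt (verit))
  moreover have "compactin (product_topology (\<lambda>t::'i. euclidean) UNIV) (PiE UNIV (\<lambda>t. {- B t..B t}))"
    by (simp add: compactin_PiE)
  ultimately show ?thesis
    by (simp add: euclidean_product_topology)
qed

lemma tendsto_function_apply:
  "(f \<longlongrightarrow> g) F \<Longrightarrow> ((\<lambda>k. f k t) \<longlongrightarrow> (g t :: 'b::topological_space)) F"
  by (rule continuous_on_tendsto_compose[where s = UNIV and f = "\<lambda>g. g t"])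
    (auto intro: continuous_on_product_coordinates)

text \<open>
  A cluster filter of a bounded family replaces weakly convergent subsequences: by Tychonoff's
  theorem it works for all members of the family and all test vectors at once.
\<close>

lemma weak_cluster_filter:
  fixes X :: "'k \<Rightarrow> 'i \<Rightarrow> 'a::real_inner"
  assumes F: "F \<noteq> bot"
    and H: "\<And>i. i \<in> J \<Longrightarrow> hilbert_subspace (H i)"
    and B: "\<And>i. i \<in> J \<Longrightarrow> \<forall>\<^sub>F k in F. norm (X k i) \<le> B i"
    and "finite J"
  obtains F' q where "F' \<le> F" "F' \<noteq> bot" "\<And>i. i \<in> J \<Longrightarrow> q i \<in> H i"
    "\<And>i h. i \<in> J \<Longrightarrow> h \<in> H i \<Longrightarrow> ((\<lambda>k. inner (X k i) h) \<longlongrightarrow> inner (q i) h) F'"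
proof -
  \<comment> \<open>The whole family becomes one point of a function space with a coordinate for
    each pair of an index and a test vector; the value \<open>0\<close> outside \<open>J\<close>
    keeps that point inside the compact box.\<close>
  define f where "f k = (\<lambda>(i, h). if i \<in> J then inner (X k i) h else 0)" for k
  define K where "K = {g :: 'i \<times> 'a \<Rightarrow> real. \<forall>t. \<bar>g t\<bar> \<le> \<bar>B (fst t)\<bar> * norm (snd t)}"
  have "\<forall>\<^sub>F k in F. \<forall>i\<in>J. norm (X k i) \<le> B i"
    using B \<open>finite J\<close> by (simp add: eventually_ball_finite)
  then have ev: "\<forall>\<^sub>F k in F. f k \<in> K"
  proof (eventually_elim, unfold K_def, safe)
    fix k i h assume *: "\<forall>i\<in>J. norm (X k i) \<le> B i"
    show "\<bar>f k (i, h)\<bar> \<le> \<bar>B (fst (i, h))\<bar> * norm (snd (i, h))"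
    proof (cases "i \<in> J")
      case True
      have "\<bar>inner (X k i) h\<bar> \<le> norm (X k i) * norm h"
        by (rule Cauchy_Schwarz_ineq2)
      also have "\<dots> \<le> \<bar>B i\<bar> * norm h"
        using * True by (intro mult_right_mono) force+
      finally show ?thesis using True by (simp add: f_def)
    qed (simp add: f_def)
  qed
  have "compact K" unfolding K_def by (rule compact_function_box)
  moreover have "filtermap f F \<noteq> bot" using F by (simp add: filtermap_bot_iff)
  moreover have "\<forall>\<^sub>F g in filtermap f F. g \<in> K" using ev by (simp add: eventually_filtermap)
  ultimately obtain g where g: "g \<in> K" "inf (nhds g) (filtermap f F) \<noteq> bot"
    unfolding compact_filter by blast
  \<comment> \<open>Restricts \<open>F\<close> to preimages of neighbourhoods of the cluster point
    \<open>g\<close>. Nontriviality of the meet on the function side pulls back to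
    \<open>F'\<close>.\<close>
  define F' where "F' = inf F (filtercomap f (nhds g))"
  have "F' \<noteq> bot"
  proof
    assume "F' = bot"
    then have "\<forall>\<^sub>F k in inf F (filtercomap f (nhds g)). False" by (simp add: F'_def)
    then obtain P Q where PQ: "eventually P F" "eventually Q (nhds g)" "\<And>k. P k \<Longrightarrow> Q (f k) \<Longrightarrow> False"
      unfolding eventually_inf eventually_filtercomap by metis
    have "\<forall>\<^sub>F h in filtermap f F. \<not> Q h"
      unfolding eventually_filtermap using PQ(1) by eventually_elim (use PQ(3) in blast)
    with PQ(2) have "\<forall>\<^sub>F h in inf (nhds g) (filtermap f F). False"
      unfolding eventually_inf by blast
    with g(2) show False by (simp add: eventually_False)
  qed
  have "(f \<longlongrightarrow> g) F'"
    unfolding F'_def by (rule tendsto_mono[of _ "filtercomap f (nhds g)"])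
      (auto simp: filterlim_def filtermap_le_iff_le_filtercomap)
  then have lim: "((\<lambda>k. inner (X k i) h) \<longlongrightarrow> g (i, h)) F'" if "i \<in> J" for i h
    using tendsto_function_apply[of f g F' "(i, h)"] that by (simp add: f_def)
  \<comment> \<open>Limits along the nontrivial \<open>F'\<close> are unique, so
    \<open>g (i, h)\<close> inherits linearity in \<open>h\<close> from the inner products and the
    bound from \<open>K\<close>; Riesz on \<open>H i\<close> then yields the weak limit.\<close>
  have "\<exists>!x. x \<in> H i \<and> (\<forall>h\<in>H i. g (i, h) = inner h x)" if i: "i \<in> J" for i
  proof (rule riesz_representation_on[OF H[OF i], where B = "\<bar>B i\<bar>"])
    fix h h' :: 'a and c :: real
    have "((\<lambda>k. inner (X k i) (h + h')) \<longlongrightarrow> g (i, h) + g (i, h')) F'"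
      unfolding inner_add_right by (intro tendsto_intros lim i)
    then show "g (i, h + h') = g (i, h) + g (i, h')"
      by (rule tendsto_unique[OF \<open>F' \<noteq> bot\<close> lim[OF i]])
    have "((\<lambda>k. inner (X k i) (c *\<^sub>R h)) \<longlongrightarrow> c * g (i, h)) F'"
      unfolding inner_scaleR_right by (intro tendsto_intros lim i)
    then show "g (i, c *\<^sub>R h) = c * g (i, h)"
      by (rule tendsto_unique[OF \<open>F' \<noteq> bot\<close> lim[OF i]])
    show "\<bar>g (i, h)\<bar> \<le> \<bar>B i\<bar> * norm h"
      using g(1) unfolding K_def by (auto dest: spec[of _ "(i, h)"])
  qed
  then obtain q where "\<And>i. i \<in> J \<Longrightarrow> q i \<in> H i \<and> (\<forall>h\<in>H i. g (i, h) = inner h (q i))"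
    by metis
  then show thesis
    using that[of F' q] lim \<open>F' \<noteq> bot\<close> by (metis F'_def inf_le1 inner_commute)
qed

lemma Bseq_weighted_norm_sum:
  fixes X :: "nat \<Rightarrow> 'i \<Rightarrow> 'a::real_normed_vector" and c :: "'i \<Rightarrow> real"
  assumes "finite J" and c: "\<And>i. i \<in> J \<Longrightarrow> c i > 0" and i: "i \<in> J"
    and "Bseq (\<lambda>k. \<Sum>i\<in>J. c i * (norm (X k i - p i))\<^sup>2)"
  shows "Bseq (\<lambda>k. X k i)"
proof -
  obtain C where C: "\<And>k. \<bar>\<Sum>i\<in>J. c i * (norm (X k i - p i))\<^sup>2\<bar> \<le> C"
    using assms(4) unfolding Bseq_def by auto
  have "norm (X k i) \<le> norm (p i) + sqrt (C / c i)" for k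
  proof -
    have "c i * (norm (X k i - p i))\<^sup>2 \<le> (\<Sum>i\<in>J. c i * (norm (X k i - p i))\<^sup>2)"
      using c i \<open>finite J\<close> by (intro member_le_sum) (simp_all add: less_imp_le)
    also have "\<dots> \<le> C" using C[of k] by simp
    finally have "(norm (X k i - p i))\<^sup>2 \<le> C / c i"
      using c[OF i] by (simp add: field_simps)
    then have "norm (X k i - p i) \<le> sqrt (C / c i)"
      by (rule real_le_rsqrt)
    then show ?thesis
      using norm_triangle_sub[of "X k i" "p i"] by simp
  qed
  then show ?thesis by (rule BseqI')
qed

text \<open>
  Opial's argument: the squared distances to two points of \<open>S\<close> converge, and their difference is an
  affine functional of the iterates, so weak cluster points in \<open>S\<close> cannot be distinct.
\<close>

lemma opial_weak_convergence:
  fixes X :: "nat \<Rightarrow> 'i \<Rightarrow> 'a::real_inner" and c :: "'i \<Rightarrow> real"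
  assumes "finite J" and c: "\<And>i. i \<in> J \<Longrightarrow> c i > 0"
    and H: "\<And>i. i \<in> J \<Longrightarrow> hilbert_subspace (H i)"
    and S: "S \<noteq> {}"
    and conv: "\<And>p. p \<in> S \<Longrightarrow> convergent (\<lambda>k. \<Sum>i\<in>J. c i * (norm (X k i - p i))\<^sup>2)"
    and cluster: "\<And>F q. F \<le> sequentially \<Longrightarrow> F \<noteq> bot \<Longrightarrow> (\<And>i. i \<in> J \<Longrightarrow> q i \<in> H i) \<Longrightarrow>
      (\<And>i h. i \<in> J \<Longrightarrow> h \<in> H i \<Longrightarrow> ((\<lambda>k. inner (X k i) h) \<longlongrightarrow> inner (q i) h) F) \<Longrightarrow> q \<in> S"
  obtains q where "q \<in> S" "\<And>i. i \<in> J \<Longrightarrow> q i \<in> H i"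
    "\<And>i h. i \<in> J \<Longrightarrow> h \<in> H i \<Longrightarrow> (\<lambda>k. inner (X k i) h) \<longlonglongrightarrow> inner (q i) h"
proof -
  from S obtain p0 where "p0 \<in> S" by blast
  have "\<exists>B. \<forall>k. norm (X k i) \<le> B" if "i \<in> J" for i
    using Bseq_weighted_norm_sum[OF \<open>finite J\<close> c that convergent_imp_Bseq[OF conv[OF \<open>p0 \<in> S\<close>]]]
    unfolding Bseq_def by blast
  then obtain B where B: "\<And>k i. i \<in> J \<Longrightarrow> norm (X k i) \<le> B i"
    by metis
  \<comment> \<open>Elimination rule: every nontrivial filter below \<open>sequentially\<close> has
    a finer one with a weak limit in \<open>S\<close>. It is used for \<open>sequentially\<close>
    itself and again for a filter on which convergence fails.\<close>
  have cl: thesis'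
    if "F \<noteq> bot" "F \<le> sequentially"
      "\<And>F' q. F' \<le> F \<Longrightarrow> F' \<noteq> bot \<Longrightarrow> (\<And>i. i \<in> J \<Longrightarrow> q i \<in> H i) \<Longrightarrow>
        (\<And>i h. i \<in> J \<Longrightarrow> h \<in> H i \<Longrightarrow> ((\<lambda>k. inner (X k i) h) \<longlongrightarrow> inner (q i) h) F') \<Longrightarrow>
        q \<in> S \<Longrightarrow> thesis'" for F thesis'
    using that(1)
  proof (rule weak_cluster_filter[where J = J and H = H and X = X and B = B])
    fix F' q
    assume F': "F' \<le> F" "F' \<noteq> bot" "\<And>i. i \<in> J \<Longrightarrow> q i \<in> H i"
      "\<And>i h. i \<in> J \<Longrightarrow> h \<in> H i \<Longrightarrow> ((\<lambda>k. inner (X k i) h) \<longlongrightarrow> inner (q i) h) F'"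
    have "q \<in> S"
      using F' that(2) by (intro cluster[of F' q]) auto
    then show thesis' using that(3) F' by blast
  qed (use H B \<open>finite J\<close> in auto)
  have unique: "p i = q i"
    if p: "p \<in> S" "\<And>i. i \<in> J \<Longrightarrow> p i \<in> H i" "F \<noteq> bot" "F \<le> sequentially"
      "\<And>i h. i \<in> J \<Longrightarrow> h \<in> H i \<Longrightarrow> ((\<lambda>k. inner (X k i) h) \<longlongrightarrow> inner (p i) h) F"
      and q: "q \<in> S" "\<And>i. i \<in> J \<Longrightarrow> q i \<in> H i" "F' \<noteq> bot" "F' \<le> sequentially"
      "\<And>i h. i \<in> J \<Longrightarrow> h \<in> H i \<Longrightarrow> ((\<lambda>k. inner (X k i) h) \<longlongrightarrow> inner (q i) h) F'"
      and i: "i \<in> J"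
    for p q F F' i
  proof -
    define r where "r k = (\<Sum>i\<in>J. c i * (norm (X k i - p i))\<^sup>2) - (\<Sum>i\<in>J. c i * (norm (X k i - q i))\<^sup>2)" for k
    define a where "a = (\<Sum>i\<in>J. c i * ((norm (p i))\<^sup>2 - (norm (q i))\<^sup>2))"
    have r_eq: "r = (\<lambda>k. (\<Sum>i\<in>J. 2 * c i * inner (X k i) (q i - p i)) + a)"
    proof
      fix k
      show "r k = (\<Sum>i\<in>J. 2 * c i * inner (X k i) (q i - p i)) + a"
        unfolding r_def a_def sum_subtractf[symmetric] sum.distrib[symmetric]
        by (intro sum.cong refl)
          (simp add: power2_norm_eq_inner inner_diff inner_commute algebra_simps)
    qed
    obtain l where l: "r \<longlonglongrightarrow> l"
      using convergent_diff[OF conv[OF p(1)] conv[OF q(1)]] unfolding r_def convergent_def by blast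
    have mem: "q i - p i \<in> H i" if "i \<in> J" for i
      using p(2) q(2) H that by (simp add: hilbert_subspace_def subspace_diff)
    have "(r \<longlongrightarrow> (\<Sum>i\<in>J. 2 * c i * inner (p i) (q i - p i)) + a) F"
      unfolding r_eq by (intro tendsto_intros p(5) mem)
    then have "(\<Sum>i\<in>J. 2 * c i * inner (p i) (q i - p i)) + a = l"
      using tendsto_unique[OF p(3)] tendsto_mono[OF p(4) l] by blast
    moreover have "(r \<longlongrightarrow> (\<Sum>i\<in>J. 2 * c i * inner (q i) (q i - p i)) + a) F'"
      unfolding r_eq by (intro tendsto_intros q(5) mem)
    then have "(\<Sum>i\<in>J. 2 * c i * inner (q i) (q i - p i)) + a = l"
      using tendsto_unique[OF q(3)] tendsto_mono[OF q(4) l] by blast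
    ultimately have "(\<Sum>i\<in>J. 2 * c i * inner (q i) (q i - p i)) - (\<Sum>i\<in>J. 2 * c i * inner (p i) (q i - p i)) = 0"
      by simp
    \<comment> \<open>By linearity the difference of the two expressions for \<open>l\<close> is
      twice the weighted squared distance of \<open>p\<close> and \<open>q\<close>.\<close>
    then have "(\<Sum>i\<in>J. 2 * c i * (norm (q i - p i))\<^sup>2) = 0"
      unfolding sum_subtractf[symmetric]
      by (simp add: power2_norm_eq_inner inner_diff_left algebra_simps)
    then have "2 * c i * (norm (q i - p i))\<^sup>2 = 0"
      using sum_nonneg_eq_0_iff[of J "\<lambda>i. 2 * c i * (norm (q i - p i))\<^sup>2"] c i \<open>finite J\<close>
      by (simp add: less_imp_le)
    then show ?thesis using c[OF i] by simp
  qed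
  show thesis
  proof (rule cl[of sequentially])
    fix F q
    assume q: "F \<le> sequentially" "F \<noteq> bot" "\<And>i. i \<in> J \<Longrightarrow> q i \<in> H i"
      "\<And>i h. i \<in> J \<Longrightarrow> h \<in> H i \<Longrightarrow> ((\<lambda>k. inner (X k i) h) \<longlongrightarrow> inner (q i) h) F" "q \<in> S"
    have "(\<lambda>k. inner (X k i) h) \<longlonglongrightarrow> inner (q i) h" if ih: "i \<in> J" "h \<in> H i" for i h
    proof (rule ccontr)
      assume "\<not> (\<lambda>k. inner (X k i) h) \<longlonglongrightarrow> inner (q i) h"
      then obtain \<epsilon> where \<epsilon>: "\<epsilon> > 0" "\<not> (\<forall>\<^sub>F k in sequentially. dist (inner (X k i) h) (inner (q i) h) < \<epsilon>)"
        unfolding tendsto_iff by blast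
      \<comment> \<open>If convergence fails, the indices in \<open>?far\<close> recur, so
        restricting \<open>sequentially\<close> to them is nontrivial. A weak cluster point along
        this restriction must agree with \<open>q\<close> by \<open>unique\<close>, which is
        incompatible with staying away from it.\<close>
      let ?far = "{k. \<not> dist (inner (X k i) h) (inner (q i) h) < \<epsilon>}"
      have "inf sequentially (principal ?far) \<noteq> bot"
        using \<epsilon>(2) by (simp add: trivial_limit_def eventually_inf_principal)
      then show False
      proof (rule cl)
        fix F' q'
        assume q': "F' \<le> inf sequentially (principal ?far)" "F' \<noteq> bot" "\<And>i. i \<in> J \<Longrightarrow> q' i \<in> H i"
          "\<And>i h. i \<in> J \<Longrightarrow> h \<in> H i \<Longrightarrow> ((\<lambda>k. inner (X k i) h) \<longlongrightarrow> inner (q' i) h) F'" "q' \<in> S"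
        have "q' i = q i"
          using unique[of q' F' q F i] q q' ih(1) by simp
        then have "\<forall>\<^sub>F k in F'. dist (inner (X k i) h) (inner (q i) h) < \<epsilon>"
          using q'(4)[OF ih] \<epsilon>(1) by (simp add: tendsto_iff)
        moreover have "\<forall>\<^sub>F k in F'. k \<in> ?far"
          using q'(1) by (simp add: le_principal)
        ultimately have "\<forall>\<^sub>F k in F'. False"
          by eventually_elim simp
        then show False using q'(2) by (simp add: eventually_False)
      qed simp
    qed
    then show thesis using that q by blast
  qed simp_all
qed

section \<open>Bounded and vanishing sequences\<close>

lemma Bseq_plus: "Bseq f \<Longrightarrow> Bseq g \<Longrightarrow> Bseq (\<lambda>k. f k + g k :: 'a::real_normed_vector)"
  by (simp add: Bseq_eq_bounded bounded_plus_comp)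

lemma Bseq_minus: "Bseq f \<Longrightarrow> Bseq g \<Longrightarrow> Bseq (\<lambda>k. f k - g k :: 'a::real_normed_vector)"
  by (simp add: Bseq_eq_bounded bounded_minus_comp)

lemma Bseq_scaleR: "Bseq r \<Longrightarrow> Bseq g \<Longrightarrow> Bseq (\<lambda>k. r k *\<^sub>R g k :: 'a::real_normed_vector)"
proof (elim BseqE)
  fix K K' :: real assume "0 < K" "\<forall>k. norm (r k) \<le> K" "\<forall>k. norm (g k) \<le> K'"
  then have "norm (r k *\<^sub>R g k) \<le> K * K'" for k
    by (simp add: mult_mono')
  then show ?thesis by (rule BseqI')
qed

lemma Bseq_bounded_linear: "bounded_linear A \<Longrightarrow> Bseq f \<Longrightarrow> Bseq (\<lambda>k. A (f k))"
  using bounded_linear_image[of "range f" A] by (simp add: Bseq_eq_bounded image_image)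

lemma Bseq_finite_sum:
  "(\<And>i. i \<in> J \<Longrightarrow> Bseq (\<lambda>k. f k i)) \<Longrightarrow> Bseq (\<lambda>k. \<Sum>i\<in>J. f k i :: 'a::real_normed_vector)"
  by (induction J rule: infinite_finite_induct) (simp_all add: Bseq_plus)

lemma Bseq_eventually_eq:
  "\<forall>\<^sub>F k in sequentially. f k = g k \<Longrightarrow> Bseq g \<Longrightarrow> Bseq (f :: nat \<Rightarrow> 'a::real_normed_vector)"
  by (rule Bseq_eventually_mono[of f g]) (auto elim: eventually_mono)

lemma tendsto_zero_of_power2_le:
  fixes f :: "nat \<Rightarrow> 'a::real_normed_vector"
  assumes "\<forall>\<^sub>F k in sequentially. (norm (f k))\<^sup>2 \<le> C * g k" and "g \<longlonglongrightarrow> 0"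
  shows "f \<longlonglongrightarrow> 0"
proof -
  have "(\<lambda>k. C * g k) \<longlonglongrightarrow> C * 0"
    by (intro tendsto_intros assms)
  then have "(\<lambda>k. (norm (f k))\<^sup>2) \<longlonglongrightarrow> 0"
    by (intro Lim_null_comparison[of "\<lambda>k. (norm (f k))\<^sup>2" "\<lambda>k. C * g k"]) (use assms(1) in auto)
  then have "(\<lambda>k. sqrt ((norm (f k))\<^sup>2)) \<longlonglongrightarrow> sqrt 0"
    by (intro tendsto_intros)
  then show ?thesis
    by (simp add: tendsto_norm_zero_iff)
qed

lemma tendsto_inner_zero:
  fixes f g :: "nat \<Rightarrow> 'a::real_inner"
  assumes "f \<longlonglongrightarrow> 0" "Bseq g"
  shows tendsto_inner_zero_left: "(\<lambda>k. inner (f k) (g k)) \<longlonglongrightarrow> 0"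
    and tendsto_inner_zero_right: "(\<lambda>k. inner (g k) (f k)) \<longlonglongrightarrow> 0"
proof -
  show "(\<lambda>k. inner (f k) (g k)) \<longlonglongrightarrow> 0"
    using bounded_bilinear.Zfun_prod_Bfun[OF bounded_bilinear_inner] assms
    by (simp add: tendsto_Zfun_iff)
  then show "(\<lambda>k. inner (g k) (f k)) \<longlonglongrightarrow> 0"
    by (simp add: inner_commute)
qed

text \<open>For a constant lag the difference telescopes into finitely many vanishing increments. A
  variable lag of at most \<open>N\<close> is dominated by the sum over all constant lags up to
  \<open>N\<close>.\<close>

lemma lagged_diff_tendsto_zero:
  fixes X :: "nat \<Rightarrow> 'a::real_normed_vector"
  assumes step: "(\<lambda>k. X (Suc k) - X k) \<longlonglongrightarrow> 0"
    and lag: "\<forall>\<^sub>F k in sequentially. l k \<le> k \<and> k - l k \<le> N"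
  shows "(\<lambda>k. X k - X (l k)) \<longlonglongrightarrow> 0"
proof -
  have fixed_lag: "(\<lambda>k. X k - X (k - j)) \<longlonglongrightarrow> 0" for j
  proof (rule LIMSEQ_offset[where k = j])
    show "(\<lambda>k. X (k + j) - X (k + j - j)) \<longlonglongrightarrow> 0"
    proof (induction j)
      case (Suc j)
      have "(\<lambda>k. X (Suc (k + j)) - X (k + j)) \<longlonglongrightarrow> 0"
        using LIMSEQ_ignore_initial_segment[OF step, of j] by simp
      from tendsto_add[OF this Suc] show ?case by simp
    qed simp
  qed
  have "(\<lambda>k. \<Sum>j\<in>{..N}. norm (X k - X (k - j))) \<longlonglongrightarrow> (\<Sum>j\<in>{..N}. 0)"
    by (intro tendsto_sum tendsto_norm_zero fixed_lag)
  then have lim: "(\<lambda>k. \<Sum>j\<in>{..N}. norm (X k - X (k - j))) \<longlonglongrightarrow> 0" by simp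
  show ?thesis
    by (rule Lim_null_comparison[OF _ lim], use lag in eventually_elim)
      (use member_le_sum[of "k - l k" "{..N}" "\<lambda>j. norm (X k - X (k - j))" for k]
        in \<open>metis atMost_iff diff_diff_cancel finite_atMost norm_ge_zero\<close>)
qed

text \<open>\<open>V\<close> is eventually decreasing and bounded below, hence convergent; its
  consecutive differences therefore vanish, and \<open>r\<close> lies between \<open>0\<close> and
  them.\<close>

lemma decreasing_with_slack:
  fixes V r :: "nat \<Rightarrow> real"
  assumes "\<And>k. k \<ge> N \<Longrightarrow> V (Suc k) \<le> V k - r k"
    and "\<And>k. V k \<ge> 0" and "\<And>k. k \<ge> N \<Longrightarrow> r k \<ge> 0"
  shows "convergent V" and "r \<longlonglongrightarrow> 0"
proof -
  have "decseq (\<lambda>k. V (k + N))"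
    using assms(1,3) by (intro decseq_SucI) (smt (verit) add_Suc le_add2)
  then obtain L where L: "(\<lambda>k. V (k + N)) \<longlonglongrightarrow> L"
    using decseq_convergent[of "\<lambda>k. V (k + N)" 0] assms(2) by blast
  then have V: "V \<longlonglongrightarrow> L" by (rule LIMSEQ_offset)
  then show "convergent V" by (rule convergentI)
  have "(\<lambda>k. V k - V (Suc k)) \<longlonglongrightarrow> L - L"
    by (intro tendsto_diff V LIMSEQ_Suc)
  then have lim: "(\<lambda>k. V k - V (Suc k)) \<longlonglongrightarrow> 0" by simp
  show "r \<longlonglongrightarrow> 0"
    by (rule Lim_null_comparison[OF _ lim])
      (use assms(1,3) in \<open>auto simp: eventually_sequentially intro!: exI[of _ N]; force\<close>)
qed

section \<open>Monotone operators\<close>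

text \<open>Adding the pair \<open>(g, w)\<close> to the graph keeps it monotone, and maximality
  forbids a proper extension.\<close>

lemma maximal_monotone_mem:
  assumes T: "maximal_monotone_operator H T" and "g \<in> H" "w \<in> H"
    and mono: "\<And>a b. a \<in> H \<Longrightarrow> b \<in> T a \<Longrightarrow> 0 \<le> inner (g - a) (w - b)"
  shows "w \<in> T g"
proof -
  define S where "S x = (if x = g then insert w (T x) else T x)" for x
  have mono': "0 \<le> inner (a - g) (b - w)" if "a \<in> H" "b \<in> T a" for a b
    using mono[OF that] by (simp add: inner_diff algebra_simps)
  have "monotone_operator H T"
    using T by (simp add: maximal_monotone_operator_def)
  then have "monotone_operator H S"
    using assms(2,3) mono mono' unfolding monotone_operator_def S_def
    by (auto split: if_splits)
  moreover have "\<forall>x\<in>H. T x \<subseteq> S x" by (auto simp: S_def)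
  ultimately have "S g = T g"
    using T \<open>g \<in> H\<close> unfolding maximal_monotone_operator_def by blast
  then show ?thesis by (auto simp: S_def)
qed

text \<open>Forward operators are not assumed maximal; continuity on the full domain replaces this.
  Testing at \<open>g + t *\<^sub>R h\<close> with \<open>h = w - F g\<close> shows that
  \<open>F\<close> has to move by at least \<open>norm h\<close> in the direction of
  \<open>h\<close>, while over the distance \<open>t * norm h\<close> it moves by at most
  \<open>L * t * norm h\<close>. For small \<open>t\<close> this forces
  \<open>h = 0\<close>.\<close>

lemma lipschitz_monotone_mem:
  assumes "subspace H"
    and single: "\<And>v. v \<in> H \<Longrightarrow> T v = {F v}" and F: "\<And>v. v \<in> H \<Longrightarrow> F v \<in> H"
    and lip: "L-lipschitz_on H F"
    and "g \<in> H" "w \<in> H"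
    and mono: "\<And>a b. a \<in> H \<Longrightarrow> b \<in> T a \<Longrightarrow> 0 \<le> inner (g - a) (w - b)"
  shows "w \<in> T g"
proof -
  define h where "h = w - F g"
  have "h \<in> H" unfolding h_def using assms by (simp add: subspace_diff)
  have "L \<ge> 0" using lip by (rule lipschitz_on_nonneg)
  have key: "(norm h)\<^sup>2 \<le> t * (L * (norm h)\<^sup>2)" if "t > 0" for t
  proof -
    define a where "a = g + t *\<^sub>R h"
    have "a \<in> H" unfolding a_def using \<open>h \<in> H\<close> assms by (simp add: subspace_add subspace_scale)
    then have "0 \<le> inner (g - a) (w - F a)" using mono single by blast
    then have "0 \<le> - (t * inner h (w - F a))" by (simp add: a_def)
    then have "inner h (w - F a) \<le> 0" using that by (simp add: mult_le_0_iff)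
    then have "(norm h)\<^sup>2 \<le> inner h (F a - F g)"
      unfolding power2_norm_eq_inner by (simp add: h_def inner_diff_right)
    also have "\<dots> \<le> norm h * norm (F a - F g)" by (rule norm_cauchy_schwarz)
    also have "\<dots> \<le> norm h * (L * norm (a - g))"
      using lipschitz_onD[OF lip \<open>a \<in> H\<close> \<open>g \<in> H\<close>] by (intro mult_left_mono) (simp_all add: dist_norm)
    finally show ?thesis using that by (simp add: a_def power2_eq_square mult_ac)
  qed
  \<comment> \<open>With this \<open>t\<close> the factor \<open>t * L\<close> is at most one half,
    also when \<open>L = 0\<close>.\<close>
  have "(norm h)\<^sup>2 \<le> inverse (2 * (L + 1)) * (L * (norm h)\<^sup>2)"
    using \<open>L \<ge> 0\<close> by (intro key) simp
  also have "\<dots> = (L / (2 * (L + 1))) * (norm h)\<^sup>2"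
    by (simp add: field_simps)
  also have "\<dots> \<le> (1/2) * (norm h)\<^sup>2"
    using \<open>L \<ge> 0\<close> by (intro mult_right_mono) (auto simp: field_simps)
  finally have "h = 0" by simp
  then show ?thesis using single \<open>g \<in> H\<close> by (simp add: h_def)
qed

section \<open>The Kuhn-Tucker set\<close>

locale kuhn_tucker_problem =
  fixes H :: "nat \<Rightarrow> 'a::real_inner set"
    and T :: "nat \<Rightarrow> 'a \<Rightarrow> 'a set"
    and G :: "nat \<Rightarrow> 'a \<Rightarrow> 'a"
    and L :: "nat \<Rightarrow> real"
    and n :: nat
    and IF IB :: "nat set"
  assumes n_pos: "n \<ge> 1"
    and H_hilbert: "\<And>i. i < n \<Longrightarrow> hilbert_subspace (H i)"
    and H_n: "H n = H 0"
    and IF_IB: "IF \<union> IB = {1..n}"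
    and T_mono: "\<And>i. i \<in> {1..n} \<Longrightarrow> monotone_operator (H i) (T i)"
    and T_single: "\<And>i v. i \<in> IF \<Longrightarrow> v \<in> H i \<Longrightarrow> is_singleton (T i v)"
    and T_lipschitz: "\<And>i. i \<in> IF \<Longrightarrow> (L i)-lipschitz_on (H i) (\<lambda>v. the_elem (T i v))"
    and T_maximal: "\<And>i. i \<in> IB \<Longrightarrow> maximal_monotone_operator (H i) (T i)"
    and G_bounded_linear: "\<And>i. i \<in> {1..<n} \<Longrightarrow> bounded_linear_between (H 0) (H i) (G i)"
    and G_n: "\<And>v. v \<in> H 0 \<Longrightarrow> G n v = v"
begin

abbreviation "adj i \<equiv> adjoint_on (H 0) (G i)"

abbreviation "F i v \<equiv> the_elem (T i v)"

lemma sum_split_last: "(\<Sum>i\<in>{1..n}. f i) = (\<Sum>i\<in>{1..<n}. f i) + (f n :: 'b::comm_monoid_add)"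
proof -
  have "{1..n} = insert n {1..<n}" using n_pos by auto
  then show ?thesis by (simp add: add.commute)
qed

lemma hilbert: "i \<le> n \<Longrightarrow> hilbert_subspace (H i)"
  using H_hilbert[of i] H_hilbert[of 0] H_n n_pos by (cases "i = n") auto

lemma subsp: "i \<le> n \<Longrightarrow> subspace (H i)"
  using hilbert by (simp add: hilbert_subspace_def)

lemma G_linear_between: "i \<in> {1..n} \<Longrightarrow> bounded_linear_between (H 0) (H i) (G i)"
proof (cases "i = n")
  case True
  then show ?thesis
    using bounded_linear_between_ident[of "H 0"] H_n G_n subsp[of 0]
    by (simp add: bounded_linear_between_def Pi_iff subspace_add subspace_scale)
qed (use G_bounded_linear in auto)

lemma G_mem: "i \<in> {1..n} \<Longrightarrow> v \<in> H 0 \<Longrightarrow> G i v \<in> H i"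
  using G_linear_between[of i] by (auto simp: bounded_linear_between_def)

lemma adj_mem: "i \<in> {1..n} \<Longrightarrow> adj i y \<in> H 0"
  using adjoint_on_mem[OF hilbert G_linear_between] by simp

lemma inner_adj: "i \<in> {1..n} \<Longrightarrow> h \<in> H 0 \<Longrightarrow> inner h (adj i y) = inner (G i h) y"
  using inner_adjoint_on[OF hilbert G_linear_between] by simp

lemma bounded_linear_adj: "i \<in> {1..n} \<Longrightarrow> bounded_linear (adj i)"
  using bounded_linear_adjoint_on[OF hilbert G_linear_between] by simp

lemma adj_n: "y \<in> H 0 \<Longrightarrow> adj n y = y"
  using adjoint_on_eqI[OF hilbert G_linear_between, of n y y] n_pos G_n by simp

text \<open>The orthogonal projection onto \<open>H 0\<close>, obtained as the adjoint of the
  inclusion of \<open>H 0\<close> into the surrounding type.\<close>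

definition proj :: "'a \<Rightarrow> 'a" where
  "proj = adjoint_on (H 0) (\<lambda>v. v)"

lemma proj_mem: "proj v \<in> H 0"
  unfolding proj_def by (rule adjoint_on_mem[OF hilbert bounded_linear_between_ident]) simp

lemma proj_ident: "v \<in> H 0 \<Longrightarrow> proj v = v"
  unfolding proj_def by (rule adjoint_on_eqI[OF hilbert bounded_linear_between_ident]) simp_all

lemma bounded_linear_proj: "bounded_linear proj"
  unfolding proj_def by (rule bounded_linear_adjoint_on[OF hilbert bounded_linear_between_ident]) simp

text \<open>
  The projection extends \<^term>\<open>G i\<close> to the whole type, where the library calculus of bounded
  linear maps applies.
\<close>

lemma bounded_linear_G_proj:
  assumes "i \<in> {1..n}"
  shows "bounded_linear (\<lambda>v. G i (proj v))"
proof -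
  interpret P: bounded_linear proj by (rule bounded_linear_proj)
  obtain B where B: "\<And>v. v \<in> H 0 \<Longrightarrow> norm (G i v) \<le> B * norm v"
    using G_linear_between[OF assms] unfolding bounded_linear_between_def by blast
  obtain C where C: "\<And>v. norm (proj v) \<le> norm v * C"
    using P.bounded by blast
  show ?thesis
  proof (rule bounded_linear_intro[where K = "\<bar>B\<bar> * C"])
    fix v v' and c :: real
    show "G i (proj (v + v')) = G i (proj v) + G i (proj v')"
      "G i (proj (c *\<^sub>R v)) = c *\<^sub>R G i (proj v)"
      using G_linear_between[OF assms] proj_mem
      by (simp_all add: bounded_linear_between_def P.add P.scaleR)
    have "norm (G i (proj v)) \<le> B * norm (proj v)"
      by (rule B[OF proj_mem])
    also have "\<dots> \<le> \<bar>B\<bar> * norm (proj v)"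
      by (intro mult_right_mono) auto
    also have "\<dots> \<le> \<bar>B\<bar> * (norm v * C)"
      by (intro mult_left_mono C) auto
    finally show "norm (G i (proj v)) \<le> norm v * (\<bar>B\<bar> * C)"
      by (simp add: mult_ac)
  qed
qed

lemma T_single_eq: "i \<in> IF \<Longrightarrow> v \<in> H i \<Longrightarrow> T i v = {F i v}"
  using T_single[of i v] by (metis is_singleton_def the_elem_eq)

lemma T_subset: "i \<in> {1..n} \<Longrightarrow> v \<in> H i \<Longrightarrow> T i v \<subseteq> H i"
  using T_mono[of i] by (auto simp: monotone_operator_def)

lemma F_mem: "i \<in> IF \<Longrightarrow> v \<in> H i \<Longrightarrow> F i v \<in> H i"
  using T_single_eq[of i v] T_subset[of i v] IF_IB by blast

lemma T_monotone:
  "i \<in> {1..n} \<Longrightarrow> a \<in> H i \<Longrightarrow> b \<in> T i a \<Longrightarrow> a' \<in> H i \<Longrightarrow> b' \<in> T i a' \<Longrightarrow>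
    0 \<le> inner (a - a') (b - b')"
  using T_mono[of i] by (simp add: monotone_operator_def)

text \<open>From here on forward and backward blocks share one membership criterion, and limits need
  no case distinction.\<close>

lemma T_memI:
  assumes "i \<in> {1..n}" "g \<in> H i" "w \<in> H i"
    and "\<And>a b. a \<in> H i \<Longrightarrow> b \<in> T i a \<Longrightarrow> 0 \<le> inner (g - a) (w - b)"
  shows "w \<in> T i g"
proof (cases "i \<in> IB")
  case True
  then show ?thesis using maximal_monotone_mem[OF T_maximal] assms by blast
next
  case False
  then have "i \<in> IF" using assms IF_IB by auto
  then show ?thesis
    using lipschitz_monotone_mem[OF _ T_single_eq F_mem T_lipschitz, of i g w] assms subsp[of i] by simp
qed

text \<open>Completes the \<open>n - 1\<close> dual variables by the one that makes the adjoint
  images sum to zero. The Kuhn-Tucker conditions become \<open>n\<close> inclusions of the same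
  shape, and \<open>w n k\<close> of an executed iteration is exactly this completion.\<close>

definition dual :: "(nat \<Rightarrow> 'a) \<Rightarrow> nat \<Rightarrow> 'a" where
  "dual w i = (if i = n then - (\<Sum>j\<in>{1..<n}. adj j (w j)) else w i)"

lemma dual_less: "i \<in> {1..<n} \<Longrightarrow> dual w i = w i"
  by (simp add: dual_def)

lemma sum_adj_mem: "(\<Sum>i\<in>{1..<n}. adj i (w i)) \<in> H 0"
  using adj_mem subsp[of 0] by (intro subspace_sum) auto

lemma dual_mem: "(\<And>i. i \<in> {1..<n} \<Longrightarrow> w i \<in> H i) \<Longrightarrow> i \<in> {1..n} \<Longrightarrow> dual w i \<in> H i"
  using sum_adj_mem[of w] subsp[of 0] H_n by (auto simp: dual_def subspace_neg)

lemma kt_set_iff: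
  "(z, w) \<in> kt_set n H T G \<longleftrightarrow>
    z \<in> H 0 \<and> (\<forall>i\<in>{1..<n}. w i \<in> H i) \<and> (\<forall>i\<in>{1..n}. dual w i \<in> T i (G i z))"
proof -
  have "{1..n} = insert n {1..<n}" using n_pos by auto
  moreover have "dual w n = - (\<Sum>i\<in>{1..<n}. adj i (w i))" by (simp add: dual_def)
  ultimately show ?thesis
    using G_n[of z] by (auto simp: kt_set_def product_space_def dual_less)
qed

lemma sum_inner_G: "v \<in> H 0 \<Longrightarrow> (\<Sum>i\<in>{1..n}. inner (G i v) (y i)) = inner v (\<Sum>i\<in>{1..n}. adj i (y i))"
  by (simp add: inner_sum_right inner_adj)

lemma sum_adj_dual: "(\<Sum>i\<in>{1..n}. adj i (dual w i)) = 0"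
proof -
  have "adj n (dual w n) = dual w n"
    using sum_adj_mem[of w] subsp[of 0] by (simp add: adj_n dual_def subspace_neg)
  moreover have "(\<Sum>i\<in>{1..<n}. adj i (dual w i)) = (\<Sum>i\<in>{1..<n}. adj i (w i))"
    by (simp add: dual_less)
  ultimately show ?thesis
    unfolding sum_split_last by (simp add: dual_def)
qed

text \<open>The completed dual vectors are orthogonal to the range of the map sending
  \<open>v\<close> to the family of the \<open>G i v\<close>. Every cancellation of primal-dual
  products below rests on this.\<close>

lemma sum_inner_G_dual: "v \<in> H 0 \<Longrightarrow> (\<Sum>i\<in>{1..n}. inner (G i v) (dual w i)) = 0"
  unfolding sum_inner_G sum_adj_dual by simp

text \<open>
  Monotonicity tested on the product of the graphs suffices: were some pair outside its graph, test
  it against a violating pair and each of the others against a violating pair or itself.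
\<close>

lemma kt_set_memI:
  assumes z: "z \<in> H 0" and w: "\<And>i. i \<in> {1..<n} \<Longrightarrow> w i \<in> H i"
    and test: "\<And>a b. (\<And>i. i \<in> {1..n} \<Longrightarrow> a i \<in> H i \<and> b i \<in> T i (a i)) \<Longrightarrow>
      0 \<le> (\<Sum>i\<in>{1..n}. inner (G i z - a i) (dual w i - b i))"
  shows "(z, w) \<in> kt_set n H T G"
proof -
  have mem: "G i z \<in> H i" "dual w i \<in> H i" if "i \<in> {1..n}" for i
    using that z w G_mem dual_mem by auto
  have "\<exists>a b. i \<in> {1..n} \<longrightarrow> a \<in> H i \<and> b \<in> T i a \<and> inner (G i z - a) (dual w i - b) \<le> 0 \<and>
      (dual w i \<notin> T i (G i z) \<longrightarrow> inner (G i z - a) (dual w i - b) < 0)" for i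
  proof (cases "i \<in> {1..n} \<and> dual w i \<notin> T i (G i z)")
    case True
    then show ?thesis using T_memI[of i "G i z" "dual w i"] mem[of i] by (meson less_imp_le not_le)
  next
    case False
    then show ?thesis using mem[of i] by (intro exI[of _ "G i z"] exI[of _ "dual w i"]) auto
  qed
  then obtain a b where ab: "\<And>i. i \<in> {1..n} \<Longrightarrow> a i \<in> H i \<and> b i \<in> T i (a i)"
    "\<And>i. i \<in> {1..n} \<Longrightarrow> inner (G i z - a i) (dual w i - b i) \<le> 0"
    "\<And>i. i \<in> {1..n} \<Longrightarrow> dual w i \<notin> T i (G i z) \<Longrightarrow> inner (G i z - a i) (dual w i - b i) < 0"
    by metis
  have "dual w i \<in> T i (G i z)" if "i \<in> {1..n}" for i
  proof (rule ccontr)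
    assume "dual w i \<notin> T i (G i z)"
    then have "(\<Sum>i\<in>{1..n}. inner (G i z - a i) (dual w i - b i)) < (\<Sum>i\<in>{1..n}. 0)"
      using ab(2,3) that by (intro sum_strict_mono_ex1 ballI bexI[of _ i]) simp_all
    then show False using test[OF ab(1)] by simp
  qed
  then show ?thesis using z w by (simp add: kt_set_iff)
qed

text \<open>The left side is visibly affine in \<open>(p, q)\<close>. On the right the only term
  bilinear in \<open>p\<close> and \<open>q\<close> is the sum of the
  \<open>inner (G i p) (dual q i)\<close>, which vanishes by orthogonality. The right side is the
  form to which monotonicity applies blockwise.\<close>

lemma affine_separator_eq:
  assumes "p \<in> H 0" "x n \<in> H 0" "y n \<in> H 0"
  shows "inner p ((\<Sum>i\<in>{1..<n}. adj i (y i)) + y n) + (\<Sum>i\<in>{1..<n}. inner (q i) (x i - G i (x n)))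
      - (\<Sum>i\<in>{1..n}. inner (x i) (y i))
    = (\<Sum>i\<in>{1..n}. inner (G i p - x i) (y i - dual q i))"
proof -
  have "(\<Sum>i\<in>{1..n}. inner (G i p - x i) (y i - dual q i)) =
      (\<Sum>i\<in>{1..n}. inner (G i p) (y i)) - (\<Sum>i\<in>{1..n}. inner (G i p) (dual q i))
      - (\<Sum>i\<in>{1..n}. inner (x i) (y i)) + (\<Sum>i\<in>{1..n}. inner (x i) (dual q i))"
    by (simp add: inner_diff sum_subtractf)
  moreover have "(\<Sum>i\<in>{1..n}. inner (G i p) (y i)) = inner p ((\<Sum>i\<in>{1..<n}. adj i (y i)) + y n)"
    unfolding sum_inner_G[OF assms(1)] sum_split_last by (simp add: adj_n assms)
  moreover have "(\<Sum>i\<in>{1..n}. inner (G i p) (dual q i)) = 0"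
    by (rule sum_inner_G_dual[OF assms(1)])
  moreover have "(\<Sum>i\<in>{1..n}. inner (x i) (dual q i)) = (\<Sum>i\<in>{1..<n}. inner (q i) (x i - G i (x n)))"
  proof -
    have "inner (x n) (dual q n) = - (\<Sum>i\<in>{1..<n}. inner (G i (x n)) (q i))"
      using assms by (simp add: dual_def inner_sum_right inner_adj)
    then show ?thesis
      unfolding sum_split_last by (simp add: dual_less inner_diff sum_subtractf inner_commute)
  qed
  ultimately show ?thesis by simp
qed

end

section \<open>Runs of the algorithm\<close>

lemma last_activation_cases:
  assumes "k \<ge> 1"
  shows "last_activation I i k \<le> k"
    and "last_activation I i k \<ge> 1 \<Longrightarrow> i \<in> I (last_activation I i k)"
    and "\<lbrakk>last_activation I i k < j; j \<le> k\<rbrakk> \<Longrightarrow> i \<notin> I j"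
proof -
  let ?A = "insert 0 {j \<in> {1..k}. i \<in> I j}"
  have "Max ?A \<in> ?A" by (rule Max_in) auto
  then show "last_activation I i k \<le> k"
    and "last_activation I i k \<ge> 1 \<Longrightarrow> i \<in> I (last_activation I i k)"
    by (auto simp: last_activation_def)
  assume j: "last_activation I i k < j" "j \<le> k"
  show "i \<notin> I j"
  proof
    assume "i \<in> I j"
    then have "j \<le> Max ?A" using j by (intro Max_ge) auto
    then show False using j unfolding last_activation_def by linarith
  qed
qed

lemma last_activation_ge: "1 \<le> j \<Longrightarrow> j \<le> k \<Longrightarrow> i \<in> I j \<Longrightarrow> j \<le> last_activation I i k"
  unfolding last_activation_def by (intro Max_ge) auto

locale projective_splitting = kuhn_tucker_problem H T G L n IF IB
  for H :: "nat \<Rightarrow> 'a::real_inner set" and T G L n IF IB +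
  fixes M D :: nat
    and I :: "nat \<Rightarrow> nat set"
    and d :: "nat \<Rightarrow> nat \<Rightarrow> nat"
    and \<rho> :: "nat \<Rightarrow> nat \<Rightarrow> real"
    and \<beta> :: "nat \<Rightarrow> real"
    and \<beta>_lo \<beta>_hi \<gamma> \<sigma> :: real
    and e x y w :: "nat \<Rightarrow> nat \<Rightarrow> 'a"
    and z :: "nat \<Rightarrow> 'a"
  assumes kt_nonempty: "kt_set n H T G \<noteq> {}"
    and I_subset: "\<And>k. k \<ge> 1 \<Longrightarrow> I k \<subseteq> {1..n}"
    and d_range: "\<And>i k. i \<in> {1..n} \<Longrightarrow> k \<ge> 1 \<Longrightarrow> d i k \<in> {1..k}"
    and \<rho>_pos: "\<And>i k. i \<in> {1..n} \<Longrightarrow> k \<ge> 1 \<Longrightarrow> \<rho> i k > 0"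
    and \<beta>_lo_pos: "0 < \<beta>_lo" and \<beta>_hi_less: "\<beta>_hi < 2"
    and \<beta>_range: "\<And>k. k \<ge> 1 \<Longrightarrow> \<beta> k \<in> {\<beta>_lo..\<beta>_hi}"
    and \<gamma>_pos: "\<gamma> > 0"
    and e_mem: "\<And>i k. i \<in> IB \<Longrightarrow> k \<ge> 1 \<Longrightarrow> e i k \<in> H i"
    and run: "projective_splitting_run n H T G IF IB I d \<rho> \<beta> \<gamma> e z w x y"
    and M_pos: "M \<ge> 1"
    and I_cover: "\<And>j. j \<ge> 1 \<Longrightarrow> (\<Union>k\<in>{j..j + M - 1}. I k) = {1..n}"
    and d_delay: "\<And>i k. k \<ge> 1 \<Longrightarrow> i \<in> I k \<Longrightarrow> k - d i k \<le> D"
    and \<rho>_inf: "(INF i\<in>{1..n}. INF k\<in>{1..}. ereal (\<rho> i k)) > 0"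
    and \<rho>_sup: "(SUP i\<in>IB. SUP k\<in>{1..}. ereal (\<rho> i k)) < \<infinity>"
    and \<rho>_limsup: "\<And>i. i \<in> IF \<Longrightarrow> limsup (\<lambda>k. ereal (\<rho> i k)) < 1 / ereal (L i)"
    and e_bounded: "\<And>i. i \<in> IB \<Longrightarrow> bounded (e i ` {1..})"
    and \<sigma>_less: "\<sigma> < 1"
    and e_x: "\<And>i k. i \<in> IB \<Longrightarrow> executed n H G I \<gamma> x y k \<Longrightarrow> last_activation I i k \<ge> 1 \<Longrightarrow>
           inner (G i (z (last_info I d i k)) - x i k) (e i (last_activation I i k))
           \<ge> - \<sigma> * (norm (G i (z (last_info I d i k)) - x i k))\<^sup>2"
    and e_y: "\<And>i k. i \<in> IB \<Longrightarrow> executed n H G I \<gamma> x y k \<Longrightarrow> last_activation I i k \<ge> 1 \<Longrightarrow>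
           inner (e i (last_activation I i k)) (y i k - w i (last_info I d i k))
           \<le> \<rho> i (last_info I d i k) * \<sigma> * (norm (y i k - w i (last_info I d i k)))\<^sup>2"
begin

abbreviation "exec \<equiv> executed n H G I \<gamma> x y"
abbreviation "ret \<equiv> return_test n H G I \<gamma> x y"
abbreviation "u \<equiv> resid_u n G x"
abbreviation "v \<equiv> resid_v n H G y"
abbreviation "\<pi> \<equiv> grad_norm2 n H G \<gamma> x y"
abbreviation "\<phi> \<equiv> separator n H G z w x y"
abbreviation "\<alpha> \<equiv> step_alpha n H G \<beta> \<gamma> z w x y"
abbreviation "s \<equiv> last_activation I"
abbreviation "l \<equiv> last_info I d"

lemma exec_pos: "exec k \<Longrightarrow> 1 \<le> k"
  by (simp add: executed_def)

lemma exec_mono: "exec k \<Longrightarrow> 1 \<le> j \<Longrightarrow> j \<le> k \<Longrightarrow> exec j"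
  by (simp add: executed_def)

lemma exec_prev: "exec (Suc k) \<Longrightarrow> 1 \<le> k \<Longrightarrow> exec k \<and> \<not> ret k"
  by (simp add: executed_def)

lemma initial:
  "z 1 \<in> H 0" "i \<in> {1..<n} \<Longrightarrow> w i 1 \<in> H i" "i \<in> {1..n} \<Longrightarrow> x i 0 \<in> H i \<and> y i 0 \<in> H i"
  using run by (auto simp: projective_splitting_run_def product_space_def)

lemma w_n_eq: "exec k \<Longrightarrow> w n k = - (\<Sum>i\<in>{1..<n}. adj i (w i k))"
  using run by (simp add: projective_splitting_run_def)

lemma dual_w: "exec k \<Longrightarrow> dual (\<lambda>i. w i k) i = w i k"
  by (simp add: dual_def w_n_eq)

lemma backward_step:
  assumes "exec k" "i \<in> I k" "i \<in> IB"
  shows "x i k \<in> prox (H i) (\<rho> i (d i k)) (T i) (G i (z (d i k)) + \<rho> i (d i k) *\<^sub>R w i (d i k) + e i k)"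
    and "y i k = inverse (\<rho> i (d i k)) *\<^sub>R (G i (z (d i k)) + \<rho> i (d i k) *\<^sub>R w i (d i k) + e i k - x i k)"
  using run assms unfolding projective_splitting_run_def Let_def by blast+

lemma forward_step:
  assumes "exec k" "i \<in> I k" "i \<in> IF"
  shows "x i k = G i (z (d i k)) - \<rho> i (d i k) *\<^sub>R (F i (G i (z (d i k))) - w i (d i k))"
    and "y i k = F i (x i k)"
  using run assms unfolding projective_splitting_run_def Let_def by blast+

lemma no_step:
  assumes "exec k" "i \<in> {1..n}" "i \<notin> I k"
  shows "x i k = x i (k - 1)" "y i k = y i (k - 1)"
  using run assms unfolding projective_splitting_run_def by blast+

lemma projection_step:
  assumes "exec k" "\<not> ret k"
  shows "z (Suc k) = z k - (inverse \<gamma> * \<alpha> k) *\<^sub>R v k"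
    and "i \<in> {1..<n} \<Longrightarrow> w i (Suc k) = w i k - \<alpha> k *\<^sub>R u i k"
  using run assms unfolding projective_splitting_run_def by auto

lemma return_step:
  assumes "exec k" "ret k"
  shows "z (Suc k) = x n k" and "i \<in> {1..<n} \<Longrightarrow> w i (Suc k) = y i k"
  using run assms unfolding projective_splitting_run_def by auto

lemma iterates_mem:
  "exec k \<Longrightarrow> z k \<in> H 0 \<and> (\<forall>i\<in>{1..n}. w i k \<in> H i \<and> x i k \<in> H i \<and> y i k \<in> H i)"
proof (induction k rule: less_induct)
  case (less k)
  \<comment> \<open>\<open>z\<close> and \<open>w\<close> come first: \<open>d i k = k\<close> is
    allowed, and then the block step at \<open>k\<close> already reads them.\<close>
  have "z k \<in> H 0 \<and> (\<forall>i\<in>{1..<n}. w i k \<in> H i)"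
  proof (cases "k = 1")
    case True
    then show ?thesis using initial by simp
  next
    case False
    then obtain j where j: "k = Suc j" "1 \<le> j"
      using exec_pos[OF less.prems] by (metis One_nat_def Suc_le_D le_antisym not_less_eq_eq)
    then have *: "exec j" "\<not> ret j" using exec_prev less.prems by blast+
    have IH: "z j \<in> H 0" "\<And>i. i \<in> {1..n} \<Longrightarrow> w i j \<in> H i \<and> x i j \<in> H i \<and> y i j \<in> H i"
      using less.IH[of j] * j by auto
    have xy: "x n j \<in> H 0" "y n j \<in> H 0" using IH(2)[of n] n_pos H_n by auto
    have "v j \<in> H 0"
      unfolding resid_v_def using sum_adj_mem xy subsp[of 0] by (simp add: subspace_add)
    moreover have "u i j \<in> H i" if "i \<in> {1..<n}" for i
      unfolding resid_u_def using IH(2)[of i] G_mem[of i] xy that subsp[of i]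
      by (simp add: subspace_diff)
    ultimately show ?thesis
      using projection_step[OF *] IH subsp unfolding j
      by (simp add: subspace_diff subspace_scale)
  qed
  then have zw: "z k \<in> H 0" "\<And>i. i \<in> {1..n} \<Longrightarrow> w i k \<in> H i"
    using dual_w[OF less.prems] dual_mem[of "\<lambda>i. w i k"] by auto
  have "x i k \<in> H i \<and> y i k \<in> H i" if i: "i \<in> {1..n}" for i
  proof (cases "i \<in> I k")
    case True
    define \<delta> where "\<delta> = d i k"
    have "\<delta> \<in> {1..k}" unfolding \<delta>_def using d_range i exec_pos less.prems by blast
    then have "exec \<delta>" using exec_mono less.prems by auto
    then have *: "z \<delta> \<in> H 0" "w i \<delta> \<in> H i"
      using less.IH[of \<delta>] zw i \<open>\<delta> \<in> {1..k}\<close> by (cases "\<delta> = k"; auto)+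
    note sub = subsp[of i]
    consider "i \<in> IB" | "i \<in> IF" using IF_IB i by blast
    then show ?thesis
    proof cases
      case 1
      note step = backward_step[OF less.prems True 1, folded \<delta>_def]
      have "x i k \<in> H i" using step(1) by (simp add: prox_def)
      moreover have "e i k \<in> H i" using e_mem 1 exec_pos less.prems by blast
      ultimately show ?thesis
        unfolding step(2) using * G_mem[of i] sub i by (simp add: subspace_add subspace_diff subspace_scale)
    next
      case 2
      note step = forward_step[OF less.prems True 2, folded \<delta>_def]
      have "x i k \<in> H i"
        unfolding step(1) using * G_mem[of i] F_mem[OF 2] sub i by (simp add: subspace_diff subspace_scale)
      then show ?thesis using step(2) F_mem[OF 2] by simp
    qed
  next
    case False
    \<comment> \<open>Index \<open>0\<close> holds the initial pairs and is not an executed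
      iteration, so it is not covered by the induction hypothesis.\<close>
    have "k - 1 = 0 \<or> exec (k - 1)" using exec_mono[OF less.prems, of "k - 1"] by linarith
    then show ?thesis
      using no_step[OF less.prems i False] initial(3)[OF i] less.IH[of "k - 1"] exec_pos[OF less.prems] i
      by (cases "k - 1 = 0") auto
  qed
  with zw show ?case by blast
qed

lemma z_mem: "exec k \<Longrightarrow> z k \<in> H 0"
  and x_mem: "exec k \<Longrightarrow> i \<in> {1..n} \<Longrightarrow> x i k \<in> H i"
  and y_mem: "exec k \<Longrightarrow> i \<in> {1..n} \<Longrightarrow> y i k \<in> H i"
  using iterates_mem by blast+

lemma x_n_mem: "exec k \<Longrightarrow> x n k \<in> H 0" and y_n_mem: "exec k \<Longrightarrow> y n k \<in> H 0"
  using x_mem[of k n] y_mem[of k n] n_pos H_n by auto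

text \<open>Since its last processing a block has only been copied. This includes
  \<open>s i k = 0\<close>, where the pair is still the arbitrary initial one; graph membership
  below therefore asks for \<open>s i k \<ge> 1\<close>.\<close>

lemma iterate_last_activation:
  assumes "exec k" "i \<in> {1..n}"
  shows "x i k = x i (s i k)" and "y i k = y i (s i k)"
proof -
  have "j \<le> k \<Longrightarrow> x i j = x i (s i k) \<and> y i j = y i (s i k)" if "s i k \<le> j" for j
    using that
  proof (induction j rule: dec_induct)
    case (step j)
    have "i \<notin> I (Suc j)"
      using last_activation_cases(3)[of k I i "Suc j"] exec_pos[OF assms(1)] step by simp
    then show ?case
      using no_step[of "Suc j" i] exec_mono[OF assms(1), of "Suc j"] step assms(2) by simp
  qed simp
  from this[of k] show "x i k = x i (s i k)" "y i k = y i (s i k)"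
    using last_activation_cases(1)[of k I i] exec_pos[OF assms(1)] by auto
qed

context
  fixes i k
  assumes ik: "exec k" "i \<in> {1..n}" "s i k \<ge> 1"
begin

lemma s_props: "s i k \<le> k" "exec (s i k)" "i \<in> I (s i k)" "l i k = d i (s i k)"
  using last_activation_cases[of k I i] exec_pos[OF ik(1)] exec_mono[OF ik(1)] ik
  by (auto simp: last_info_def Let_def)

lemma l_range: "1 \<le> l i k" "l i k \<le> s i k" "exec (l i k)"
  using d_range[OF ik(2,3)] s_props exec_mono[OF s_props(2)] by auto

lemma \<rho>_l_pos: "\<rho> i (l i k) > 0"
  using \<rho>_pos ik(2) l_range by simp

text \<open>The operator value witnessing membership in \<open>prox\<close> and the computed
  \<open>y\<close> solve the same equation with a positive stepsize, so they coincide. That equation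
  is then rewritten in terms of the lagged data.\<close>

lemma backward_props:
  assumes "i \<in> IB"
  shows "y i k \<in> T i (x i k)"
    and "\<rho> i (l i k) *\<^sub>R (y i k - w i (l i k)) = G i (z (l i k)) - x i k + e i (s i k)"
proof -
  let ?a = "G i (z (l i k)) + \<rho> i (l i k) *\<^sub>R w i (l i k) + e i (s i k)"
  note step = backward_step[OF s_props(2,3) assms, folded s_props(4)
      iterate_last_activation[OF ik(1,2)]]
  from step(1) obtain t where "t \<in> T i (x i k)" "?a = x i k + \<rho> i (l i k) *\<^sub>R t"
    by (auto simp: prox_def)
  then show "y i k \<in> T i (x i k)"
    using step(2) \<rho>_l_pos by simp
  show "\<rho> i (l i k) *\<^sub>R (y i k - w i (l i k)) = G i (z (l i k)) - x i k + e i (s i k)"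
    unfolding step(2) using \<rho>_l_pos by (simp add: scaleR_right_diff_distrib algebra_simps)
qed

lemma forward_props:
  assumes "i \<in> IF"
  shows "y i k = F i (x i k)"
    and "x i k = G i (z (l i k)) - \<rho> i (l i k) *\<^sub>R (F i (G i (z (l i k))) - w i (l i k))"
  using forward_step[OF s_props(2,3) assms, folded s_props(4) iterate_last_activation[OF ik(1,2)]]
  by auto

lemma y_in_T: "y i k \<in> T i (x i k)"
proof (cases "i \<in> IB")
  case False
  then have "i \<in> IF" using IF_IB ik(2) by auto
  then show ?thesis
    using forward_props(1) T_single_eq[of i "x i k"] x_mem[OF ik(1,2)] by auto
qed (rule backward_props)

end

lemma \<pi>_zero_iff: "\<pi> k = 0 \<longleftrightarrow> (\<forall>i\<in>{1..<n}. u i k = 0) \<and> v k = 0"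
  unfolding grad_norm2_def using \<gamma>_pos
  by (subst add_nonneg_eq_0_iff) (auto simp: sum_nonneg sum_nonneg_eq_0_iff)

lemma \<pi>_nonneg: "\<pi> k \<ge> 0"
  unfolding grad_norm2_def using \<gamma>_pos by (simp add: sum_nonneg)

text \<open>Vanishing \<open>\<pi> k\<close> means \<open>x i k = G i (x n k)\<close> and that the
  \<open>y i k\<close> sum to zero under the adjoints; the covering condition excludes arbitrary
  initial pairs, so each pair lies on its graph.\<close>

lemma return_in_kt_set:
  assumes "terminates_at n H G I \<gamma> x y k"
  shows "(z (k + 1), \<lambda>i. w i (k + 1)) \<in> kt_set n H T G"
proof -
  from assms have k: "exec k" "ret k" by (simp_all add: terminates_at_def)
  then have cover: "(\<Union>j\<in>{1..k}. I j) = {1..n}" and u0: "\<And>i. i \<in> {1..<n} \<Longrightarrow> u i k = 0" and v0: "v k = 0"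
    using \<pi>_zero_iff[of k] by (auto simp: return_test_def)
  have act: "s i k \<ge> 1" if "i \<in> {1..n}" for i
  proof -
    from that cover obtain j where "j \<in> {1..k}" "i \<in> I j" by blast
    then show ?thesis using last_activation_ge[of j k i I] by simp
  qed
  have w_eq: "w i (k + 1) = y i k" if "i \<in> {1..<n}" for i
    using return_step(2)[OF k that] by simp
  have dual_eq: "dual (\<lambda>i. w i (k + 1)) i = y i k" if "i \<in> {1..n}" for i
  proof (cases "i = n")
    case True
    have "(\<Sum>j\<in>{1..<n}. adj j (w j (k + 1))) = (\<Sum>j\<in>{1..<n}. adj j (y j k))"
      by (intro sum.cong refl) (simp add: w_eq[simplified])
    then show ?thesis
      using v0 True unfolding dual_def resid_v_def by (simp add: add_eq_0_iff)
  next
    case False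
    then show ?thesis using w_eq[of i] that by (simp add: dual_def)
  qed
  have x_eq: "G i (x n k) = x i k" if "i \<in> {1..n}" for i
    using u0[of i] that G_n[OF x_n_mem[OF k(1)]] by (cases "i = n") (auto simp: resid_u_def)
  show ?thesis
    unfolding kt_set_iff
  proof (intro conjI ballI)
    show "z (k + 1) \<in> H 0" using return_step(1)[OF k] x_n_mem[OF k(1)] by simp
    show "w i (k + 1) \<in> H i" if "i \<in> {1..<n}" for i
      using w_eq[OF that] y_mem[OF k(1), of i] that by simp
    show "dual (\<lambda>i. w i (k + 1)) i \<in> T i (G i (z (k + 1)))" if "i \<in> {1..n}" for i
      using dual_eq[OF that] y_in_T[OF k(1) that act[OF that]] x_eq[OF that] return_step(1)[OF k] by simp
  qed
qed

lemma \<phi>_eq: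
  assumes "exec k"
  shows "\<phi> k = (\<Sum>i\<in>{1..n}. inner (G i (z k) - x i k) (y i k - w i k))"
  using affine_separator_eq[of "z k" "\<lambda>i. x i k" "\<lambda>i. y i k" "\<lambda>i. w i k"] assms
  by (simp add: separator_def resid_u_def resid_v_def dual_w z_mem x_n_mem y_n_mem)

end

section \<open>Weak convergence of non-terminating runs\<close>

locale nonterminating_splitting = projective_splitting +
  assumes nonterminating: "\<nexists>k. terminates_at n H G I \<gamma> x y k"
begin

section \<open>Activation windows and bounded lags\<close>

lemma exec: "1 \<le> k \<Longrightarrow> exec k"
proof (induction k rule: less_induct)
  case (less k)
  then have "\<not> ret j" if "j \<in> {1..<k}" for j
    using nonterminating that by (auto simp: terminates_at_def)
  then show ?case using less.prems by (simp add: executed_def)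
qed

lemma no_ret: "1 \<le> k \<Longrightarrow> \<not> ret k"
  using exec nonterminating by (auto simp: terminates_at_def)

lemma activated:
  assumes "k \<ge> M" "i \<in> {1..n}"
  shows "s i k \<ge> 1" and "k - s i k < M"
proof -
  \<comment> \<open>The window is the last \<open>M\<close> iterations, from
    \<open>k - M + 1\<close> up to \<open>k\<close>; it starts at \<open>1\<close> or later because
    \<open>k \<ge> M\<close>.\<close>
  have "1 \<le> k - M + 1" by simp
  from I_cover[OF this] assms(2) obtain j where "j \<in> {k - M + 1..k - M + 1 + M - 1}" "i \<in> I j"
    by blast
  then have j: "k - M + 1 \<le> j" "j \<le> k" "i \<in> I j" using assms(1) by auto
  then have "j \<le> s i k" by (intro last_activation_ge) auto
  with j show "s i k \<ge> 1" "k - s i k < M" using M_pos by auto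
qed

text \<open>The lag is the time since the last activation, below \<open>M\<close>, plus the delay
  used at that activation, at most \<open>D\<close>.\<close>

lemma lag:
  assumes "k \<ge> M" "i \<in> {1..n}"
  shows "1 \<le> l i k" "l i k \<le> k" "k - l i k \<le> M + D"
proof -
  have k: "exec k" using assms M_pos exec by simp
  note act = activated[OF assms]
  note sp = s_props[OF k assms(2) act(1)] and lr = l_range[OF k assms(2) act(1)]
  show "1 \<le> l i k" "l i k \<le> k" using sp lr by auto
  have "s i k - d i (s i k) \<le> D" using d_delay act(1) sp(3) by blast
  then show "k - l i k \<le> M + D" using sp act by simp
qed

lemma lag_eventually:
  assumes "i \<in> {1..n}"
  shows "\<forall>\<^sub>F k in sequentially. l i k \<le> k \<and> k - l i k \<le> M + D"
  using lag[OF _ assms] by (auto simp: eventually_sequentially)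

lemma filterlim_lag: "i \<in> {1..n} \<Longrightarrow> filterlim (l i) at_top sequentially"
  unfolding filterlim_at_top
proof
  fix N assume i: "i \<in> {1..n}"
  show "\<forall>\<^sub>F k in sequentially. N \<le> l i k"
    using eventually_ge_at_top[of "N + M + D"] lag_eventually[OF i] by eventually_elim auto
qed

lemma exec_eventually: "\<forall>\<^sub>F k in sequentially. exec k"
  using exec by (auto simp: eventually_sequentially)

lemma exec_M: "k \<ge> M \<Longrightarrow> exec k"
  using exec M_pos by simp

text \<open>After \<open>M\<close> iterations every block has been processed, so a zero of
  \<open>\<pi>\<close> would have triggered the return.\<close>

lemma \<pi>_pos:
  assumes "k \<ge> M"
  shows "\<pi> k > 0"
proof (rule ccontr)
  assume "\<not> \<pi> k > 0"
  then have "\<pi> k = 0" using \<pi>_nonneg[of k] by simp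
  moreover have "(\<Union>j\<in>{1..k}. I j) = {1..n}"
  proof
    show "(\<Union>j\<in>{1..k}. I j) \<subseteq> {1..n}" using I_subset by fastforce
    have "(\<Union>j\<in>{1..1 + M - 1}. I j) \<subseteq> (\<Union>j\<in>{1..k}. I j)"
      by (rule UN_mono) (use assms in auto)
    then show "{1..n} \<subseteq> (\<Union>j\<in>{1..k}. I j)" using I_cover[of 1] by simp
  qed
  ultimately show False using no_ret[of k] assms M_pos by (simp add: return_test_def)
qed

section \<open>Fejer monotonicity\<close>

text \<open>Where \<open>\<pi> k\<close> is positive, this is the squared distance of the current
  point from the half-space on which the separator is nonpositive, in the norm with weight
  \<open>\<gamma>\<close> on \<open>z\<close>; in that metric \<open>\<pi> k\<close> is the squared
  norm of the gradient.\<close>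

definition progress :: "nat \<Rightarrow> real" where
  "progress k = (max 0 (\<phi> k))\<^sup>2 / \<pi> k"

lemma progress_nonneg: "progress k \<ge> 0"
  using \<pi>_nonneg by (simp add: progress_def)

lemma \<alpha>_identities:
  assumes "k \<ge> M"
  shows "\<alpha> k * \<phi> k = \<beta> k * progress k" and "(\<alpha> k)\<^sup>2 * \<pi> k = (\<beta> k)\<^sup>2 * progress k" and "\<alpha> k \<ge> 0"
proof -
  have pos: "\<pi> k > 0" by (rule \<pi>_pos[OF assms])
  have \<alpha>: "\<alpha> k = \<beta> k / \<pi> k * max 0 (\<phi> k)" using pos by (simp add: step_alpha_def)
  have "max 0 (\<phi> k) * \<phi> k = (max 0 (\<phi> k))\<^sup>2" by (simp add: max_def power2_eq_square)
  then show "\<alpha> k * \<phi> k = \<beta> k * progress k"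
    by (simp add: \<alpha> progress_def)
  show "(\<alpha> k)\<^sup>2 * \<pi> k = (\<beta> k)\<^sup>2 * progress k"
    using pos by (simp add: \<alpha> progress_def power2_eq_square)
  show "\<alpha> k \<ge> 0"
    using pos \<beta>_range[of k] \<beta>_lo_pos assms M_pos by (simp add: \<alpha>)
qed

text \<open>Index \<open>0\<close> is free in the dual variables, so it carries the primal one. A
  point of the product, and likewise a Kuhn-Tucker point \<open>(p 0, p)\<close>, is then a single
  function on \<open>{..<n}\<close>, as Opial's argument expects.\<close>

definition point :: "nat \<Rightarrow> nat \<Rightarrow> 'a" where
  "point k i = (if i = 0 then z k else w i k)"

definition weight :: "nat \<Rightarrow> real" where
  "weight i = (if i = 0 then \<gamma> else 1)"

definition dist2 :: "(nat \<Rightarrow> 'a) \<Rightarrow> nat \<Rightarrow> real" where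
  "dist2 p k = (\<Sum>i<n. weight i * (norm (point k i - p i))\<^sup>2)"

lemma weight_pos: "weight i > 0"
  using \<gamma>_pos by (simp add: weight_def)

lemma sum_split_first: "(\<Sum>i<n. f i) = f 0 + (\<Sum>i\<in>{1..<n}. f i :: 'b::comm_monoid_add)"
proof -
  have "{..<n} = insert 0 {1..<n}" using n_pos by auto
  then show ?thesis by simp
qed

lemma dist2_eq:
  "dist2 p k = \<gamma> * (norm (z k - p 0))\<^sup>2 + (\<Sum>i\<in>{1..<n}. (norm (w i k - p i))\<^sup>2)"
  unfolding dist2_def sum_split_first by (simp add: weight_def point_def)

lemma separator_nonpos:
  assumes p: "(p 0, p) \<in> kt_set n H T G" and k: "k \<ge> M"
  shows "inner (p 0) (v k) + (\<Sum>i\<in>{1..<n}. inner (p i) (u i k)) - (\<Sum>i\<in>{1..n}. inner (x i k) (y i k)) \<le> 0"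
proof -
  have p': "p 0 \<in> H 0" "\<And>i. i \<in> {1..n} \<Longrightarrow> dual p i \<in> T i (G i (p 0))"
    using p by (auto simp: kt_set_iff)
  have ex: "exec k" by (rule exec_M[OF k])
  have "inner (G i (p 0) - x i k) (y i k - dual p i) \<le> 0" if i: "i \<in> {1..n}" for i
  proof -
    have "0 \<le> inner (G i (p 0) - x i k) (dual p i - y i k)"
      by (rule T_monotone[OF i G_mem[OF i p'(1)] p'(2)[OF i] x_mem[OF ex i] y_in_T[OF ex i activated(1)[OF k i]]])
    then show ?thesis by (simp add: inner_diff)
  qed
  then have "(\<Sum>i\<in>{1..n}. inner (G i (p 0) - x i k) (y i k - dual p i)) \<le> 0"
    by (rule sum_nonpos)
  then show ?thesis
    unfolding resid_u_def resid_v_def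
    by (simp only: affine_separator_eq[of "p 0" "\<lambda>i. x i k" "\<lambda>i. y i k" p, OF p'(1) x_n_mem[OF ex] y_n_mem[OF ex]])
qed

text \<open>Expanding the square gives a decrease of at least
  \<open>2 * \<alpha> k * \<phi> k\<close> minus \<open>\<pi> k\<close> times the square of
  \<open>\<alpha> k\<close>, since the separator is affine and nonpositive at \<open>p\<close>. By
  the choice of the step this equals \<open>\<beta> k * (2 - \<beta> k) * progress k\<close>, and
  the bounds on \<open>\<beta> k\<close> give the uniform constant.\<close>

lemma fejer:
  assumes p: "(p 0, p) \<in> kt_set n H T G" and k: "k \<ge> M"
  shows "dist2 p (Suc k) \<le> dist2 p k - \<beta>_lo * (2 - \<beta>_hi) * progress k"
proof -
  have "1 \<le> k" using k M_pos by simp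
  note step = projection_step[OF exec[OF this] no_ret[OF this]]
  have z_part: "\<gamma> * (norm (z (Suc k) - p 0))\<^sup>2 =
      \<gamma> * (norm (z k - p 0))\<^sup>2 - 2 * \<alpha> k * inner (z k - p 0) (v k) + (\<alpha> k)\<^sup>2 * (inverse \<gamma> * (norm (v k))\<^sup>2)"
  proof -
    have "(norm (z (Suc k) - p 0))\<^sup>2 = (norm (z k - p 0))\<^sup>2
      - 2 * (inverse \<gamma> * \<alpha> k) * inner (z k - p 0) (v k) + (inverse \<gamma> * \<alpha> k)\<^sup>2 * (norm (v k))\<^sup>2"
      unfolding step(1) power2_norm_eq_inner
      by (simp add: inner_diff inner_commute algebra_simps power2_eq_square)
    then show ?thesis
      using \<gamma>_pos by (simp add: field_simps power2_eq_square)
  qed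
  have w_part: "(norm (w i (Suc k) - p i))\<^sup>2 =
      (norm (w i k - p i))\<^sup>2 - 2 * \<alpha> k * inner (w i k - p i) (u i k) + (\<alpha> k)\<^sup>2 * (norm (u i k))\<^sup>2"
    if "i \<in> {1..<n}" for i
    unfolding step(2)[OF that] power2_norm_eq_inner
    by (simp add: inner_diff inner_commute algebra_simps power2_eq_square)
  have "dist2 p (Suc k) = dist2 p k
      - 2 * \<alpha> k * (inner (z k - p 0) (v k) + (\<Sum>i\<in>{1..<n}. inner (w i k - p i) (u i k))) + (\<alpha> k)\<^sup>2 * \<pi> k"
    unfolding dist2_eq z_part grad_norm2_def
    by (simp add: w_part sum.distrib sum_subtractf sum_distrib_left algebra_simps)
  also have "\<dots> \<le> dist2 p k - 2 * \<alpha> k * \<phi> k + (\<alpha> k)\<^sup>2 * \<pi> k"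
  proof -
    have "\<phi> k \<le> inner (z k - p 0) (v k) + (\<Sum>i\<in>{1..<n}. inner (w i k - p i) (u i k))"
      using separator_nonpos[of p, OF p k] unfolding separator_def
      by (simp add: inner_diff_left sum_subtractf)
    then have "\<alpha> k * \<phi> k \<le> \<alpha> k * (inner (z k - p 0) (v k) + (\<Sum>i\<in>{1..<n}. inner (w i k - p i) (u i k)))"
      using \<alpha>_identities(3)[OF k] by (rule mult_left_mono)
    then show ?thesis by simp
  qed
  also have "\<dots> = dist2 p k - \<beta> k * (2 - \<beta> k) * progress k"
    using \<alpha>_identities(1,2)[OF k] by (simp add: algebra_simps power2_eq_square)
  also have "\<dots> \<le> dist2 p k - \<beta>_lo * (2 - \<beta>_hi) * progress k"
    using \<beta>_range[OF \<open>1 \<le> k\<close>] \<beta>_lo_pos \<beta>_hi_less progress_nonneg[of k]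
    by (intro diff_left_mono mult_right_mono mult_mono) auto
  finally show ?thesis .
qed

lemma dist2_nonneg: "dist2 p k \<ge> 0"
  unfolding dist2_def using weight_pos by (simp add: sum_nonneg less_imp_le)

lemma dist2_convergent:
  assumes p: "(p 0, p) \<in> kt_set n H T G"
  shows "convergent (dist2 p)" and "progress \<longlonglongrightarrow> 0"
proof -
  let ?c = "\<beta>_lo * (2 - \<beta>_hi)"
  have c: "?c > 0" using \<beta>_lo_pos \<beta>_hi_less by simp
  note lims = decreasing_with_slack[of M "dist2 p" "\<lambda>k. ?c * progress k",
      OF fejer[OF p] dist2_nonneg mult_nonneg_nonneg[OF less_imp_le[OF c] progress_nonneg]]
  show "convergent (dist2 p)" by (rule lims)
  have "(\<lambda>k. inverse ?c * (?c * progress k)) \<longlonglongrightarrow> inverse ?c * 0"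
    by (intro tendsto_mult_left lims)
  moreover have "inverse ?c * (?c * a) = a" for a :: real
    using c by (metis left_inverse less_irrefl mult.assoc mult_1)
  ultimately show "progress \<longlonglongrightarrow> 0" by (simp only: mult_zero_right)
qed

definition solution :: "nat \<Rightarrow> 'a" where
  "solution = (SOME p. (p 0, p) \<in> kt_set n H T G)"

lemma solution: "(solution 0, solution) \<in> kt_set n H T G"
proof -
  obtain z' w' where "(z', w') \<in> kt_set n H T G"
    using kt_nonempty by auto
  \<comment> \<open>\<open>dual\<close> reads only indices from \<open>1\<close> on, so slot
    \<open>0\<close> can be overwritten by the primal part.\<close>
  moreover have "dual (w'(0 := z')) i = dual w' i" if "i \<in> {1..n}" for i
    using that unfolding dual_def by (auto intro!: sum.cong)
  ultimately have "((w'(0 := z')) 0, w'(0 := z')) \<in> kt_set n H T G"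
    unfolding kt_set_iff by auto
  then show ?thesis unfolding solution_def by (rule someI[where P = "\<lambda>p. (p 0, p) \<in> kt_set n H T G"])
qed

lemma solution_props:
  "solution 0 \<in> H 0" "i \<in> {1..n} \<Longrightarrow> dual solution i \<in> T i (G i (solution 0))"
  using solution by (auto simp: kt_set_iff)

lemma progress_tendsto_zero: "progress \<longlonglongrightarrow> 0"
  by (rule dist2_convergent[OF solution])

section \<open>Boundedness of the iterates\<close>

lemma Bseq_point: "i < n \<Longrightarrow> Bseq (\<lambda>k. point k i)"
  by (rule Bseq_weighted_norm_sum[of "{..<n}" weight i point solution])
    (use weight_pos convergent_imp_Bseq[OF dist2_convergent(1)[OF solution]] in \<open>simp_all add: dist2_def[abs_def]\<close>)

lemma Bseq_z: "Bseq z"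
  using Bseq_point[of 0] n_pos by (simp add: point_def)

lemma Bseq_w:
  assumes "i \<in> {1..n}"
  shows "Bseq (w i)"
proof (cases "i = n")
  case True
  have "Bseq (\<lambda>k. \<Sum>j\<in>{1..<n}. adj j (w j k))"
  proof (rule Bseq_finite_sum)
    fix j assume "j \<in> {1..<n}"
    then show "Bseq (\<lambda>k. adj j (w j k))"
      using Bseq_bounded_linear[OF bounded_linear_adj Bseq_point, of j j] by (simp add: point_def)
  qed
  moreover have "\<forall>\<^sub>F k in sequentially. norm (w n k) \<le> norm (\<Sum>j\<in>{1..<n}. adj j (w j k))"
    using exec_eventually by eventually_elim (simp add: w_n_eq)
  ultimately show ?thesis
    unfolding True by (rule Bseq_eventually_mono[rotated])
next
  case False
  then show ?thesis using Bseq_point[of i] assms by (simp add: point_def)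
qed

lemma Bseq_G:
  assumes i: "i \<in> {1..n}" and "Bseq f" and mem: "\<forall>\<^sub>F k in sequentially. f k \<in> H 0"
  shows "Bseq (\<lambda>k. G i (f k))"
proof -
  have "\<forall>\<^sub>F k in sequentially. norm (G i (f k)) \<le> norm (G i (proj (f k)))"
    using mem by eventually_elim (simp add: proj_ident)
  then show ?thesis
    by (rule Bseq_eventually_mono) (rule Bseq_bounded_linear[OF bounded_linear_G_proj[OF i] assms(2)])
qed

lemma tendsto_G_diff:
  assumes i: "i \<in> {1..n}" and "(\<lambda>k. f k - g k) \<longlonglongrightarrow> 0"
    and mem: "\<forall>\<^sub>F k in sequentially. f k \<in> H 0" "\<forall>\<^sub>F k in sequentially. g k \<in> H 0"
  shows "(\<lambda>k. G i (f k) - G i (g k)) \<longlonglongrightarrow> 0"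
proof -
  interpret A: bounded_linear "\<lambda>v. G i (proj v)" by (rule bounded_linear_G_proj[OF i])
  have "(\<lambda>k. G i (proj (f k - g k))) \<longlonglongrightarrow> 0"
    by (rule A.tendsto_zero[OF assms(2)])
  moreover have "\<forall>\<^sub>F k in sequentially. G i (proj (f k - g k)) = G i (f k) - G i (g k)"
    using mem by eventually_elim (simp add: A.diff proj_ident)
  ultimately show ?thesis by (rule Lim_transform_eventually)
qed

lemma z_lag_mem: "i \<in> {1..n} \<Longrightarrow> \<forall>\<^sub>F k in sequentially. z (l i k) \<in> H 0"
  unfolding eventually_sequentially by (intro exI[of _ M] allI impI z_mem exec lag(1))

lemma \<rho>_lower: obtains r where "r > 0" "\<And>i k. i \<in> {1..n} \<Longrightarrow> k \<ge> 1 \<Longrightarrow> r \<le> \<rho> i k"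
proof -
  obtain r where r: "0 < ereal r" "ereal r < (INF i\<in>{1..n}. INF k\<in>{1..}. ereal (\<rho> i k))"
    using ereal_dense2[OF \<rho>_inf] by blast
  have "r \<le> \<rho> i k" if "i \<in> {1..n}" "k \<ge> 1" for i k
  proof -
    have "(INF i\<in>{1..n}. INF k\<in>{1..}. ereal (\<rho> i k)) \<le> (INF k\<in>{1..}. ereal (\<rho> i k))"
      using that(1) by (rule INF_lower)
    also have "\<dots> \<le> ereal (\<rho> i k)"
      using that(2) by (intro INF_lower) simp
    finally have "ereal r < ereal (\<rho> i k)" by (rule less_le_trans[OF r(2)])
    then show ?thesis by simp
  qed
  moreover have "r > 0" using r(1) by simp
  ultimately show thesis using that by blast
qed

lemma \<rho>_upper: obtains R where "R > 0" "\<And>i k. i \<in> IB \<Longrightarrow> k \<ge> 1 \<Longrightarrow> \<rho> i k \<le> R"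
proof -
  obtain R where R: "(SUP i\<in>IB. SUP k\<in>{1..}. ereal (\<rho> i k)) < ereal R"
    using ereal_dense2[OF \<rho>_sup] by blast
  have "\<rho> i k \<le> max 1 R" if "i \<in> IB" "k \<ge> 1" for i k
  proof -
    have "ereal (\<rho> i k) \<le> (SUP k\<in>{1..}. ereal (\<rho> i k))"
      using that(2) by (intro SUP_upper) simp
    also have "\<dots> \<le> (SUP i\<in>IB. SUP k\<in>{1..}. ereal (\<rho> i k))"
      using that(1) by (rule SUP_upper)
    finally have "ereal (\<rho> i k) < ereal R" using R by (rule le_less_trans)
    then show ?thesis by simp
  qed
  then show thesis using that[of "max 1 R"] by simp
qed

text \<open>A real \<open>r\<close> strictly between the limsup and \<open>1 / L i\<close> leaves
  room in the forward estimate; for \<open>L i = 0\<close> the upper limit is infinite and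
  \<open>r * L i < 1\<close> is trivial. As lagged indices tend to infinity, the eventual bound
  passes to them.\<close>

lemma \<rho>_forward:
  assumes "i \<in> IF"
  obtains r where "r > 0" "r * L i < 1" "\<forall>\<^sub>F k in sequentially. \<rho> i (l i k) \<le> r"
proof -
  have i: "i \<in> {1..n}" using assms IF_IB by blast
  obtain r where r: "limsup (\<lambda>k. ereal (\<rho> i k)) < ereal r" "ereal r < 1 / ereal (L i)"
    using ereal_dense2[OF \<rho>_limsup[OF assms]] by blast
  have ev: "\<forall>\<^sub>F k in sequentially. \<rho> i k < r"
    using Limsup_lessD[OF r(1)] by simp
  then have "\<forall>\<^sub>F k in sequentially. 0 < r"
    using eventually_ge_at_top[of 1] by eventually_elim (use \<rho>_pos[OF i] in force)
  then have "r > 0" by simp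
  have "L i \<ge> 0" using T_lipschitz[OF assms] by (rule lipschitz_on_nonneg)
  then have "r * L i < 1"
    using r(2) by (cases "L i = 0") (simp_all add: one_ereal_def field_simps)
  moreover have "\<forall>\<^sub>F k in sequentially. \<rho> i (l i k) < r"
    using filterlim_lag[OF i] ev by (rule eventually_compose_filterlim[rotated])
  then have "\<forall>\<^sub>F k in sequentially. \<rho> i (l i k) \<le> r"
    by eventually_elim simp
  ultimately show thesis using that \<open>r > 0\<close> by blast
qed

lemma eventually_M: "(\<And>k. k \<ge> M \<Longrightarrow> P k) \<Longrightarrow> eventually P sequentially"
  by (auto simp: eventually_sequentially)

lemma Bseq_G_z_lag: "i \<in> {1..n} \<Longrightarrow> Bseq (\<lambda>k. G i (z (l i k)))"
  by (rule Bseq_G[OF _ Bseq_subseq[OF Bseq_z] z_lag_mem])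

lemma Bseq_w_lag: "i \<in> {1..n} \<Longrightarrow> Bseq (\<lambda>k. w i (l i k))"
  by (rule Bseq_subseq[OF Bseq_w])

lemma Bseq_F:
  assumes "i \<in> IF" "Bseq f" "\<forall>\<^sub>F k in sequentially. f k \<in> H i"
  shows "Bseq (\<lambda>k. F i (f k))"
proof -
  have "i \<le> n" using assms(1) IF_IB by auto
  then have 0: "0 \<in> H i" using subsp subspace_0 by blast
  have "\<forall>\<^sub>F k in sequentially. norm (F i (f k) - F i 0) \<le> norm (L i *\<^sub>R f k)"
    using assms(3)
  proof eventually_elim
    case (elim k)
    show ?case
      using lipschitz_onD[OF T_lipschitz[OF assms(1)] elim 0] lipschitz_on_nonneg[OF T_lipschitz[OF assms(1)]]
      by (simp add: dist_norm)
  qed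
  then have "Bseq (\<lambda>k. F i (f k) - F i 0)"
    by (rule Bseq_eventually_mono) (intro Bseq_scaleR assms Bfun_const)
  from Bseq_plus[OF this Bfun_const[of "F i 0"]] show ?thesis by simp
qed

text \<open>Backward blocks: \<open>x\<close> is a resolvent value at the bounded point
  \<open>a\<close>, and resolvents are nonexpansive, so its distance from a fixed resolvent value is
  controlled. Forward blocks: the explicit formula and the Lipschitz bound suffice.\<close>

lemma Bseq_xy:
  assumes i: "i \<in> {1..n}"
  shows "Bseq (x i) \<and> Bseq (y i)"
proof (cases "i \<in> IB")
  case True
  obtain r where r: "r > 0" "\<And>i k. i \<in> {1..n} \<Longrightarrow> k \<ge> 1 \<Longrightarrow> r \<le> \<rho> i k"
    by (metis \<rho>_lower)
  obtain R where R: "\<And>i k. i \<in> IB \<Longrightarrow> k \<ge> 1 \<Longrightarrow> \<rho> i k \<le> R"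
    by (metis \<rho>_upper)
  define q where "q k = \<rho> i (l i k)" for k
  have q: "r \<le> q k" "q k \<le> R" if "k \<ge> M" for k
    using r(2)[OF i] R[OF True] lag(1)[OF that i] by (simp_all add: q_def)
  have q_norm: "norm (q k) \<le> R" "norm (inverse (q k)) \<le> inverse r" if "k \<ge> M" for k
    using q[OF that] r(1) le_imp_inverse_le[of r "q k"] by auto
  have Bq: "Bseq q"
    by (rule BfunI[OF eventually_M]) (rule q_norm(1))
  have Bq': "Bseq (\<lambda>k. inverse (q k))"
    by (rule BfunI[OF eventually_M]) (rule q_norm(2))
  obtain C where C: "\<And>k. k \<ge> 1 \<Longrightarrow> norm (e i k) \<le> C"
    using e_bounded[OF True] unfolding bounded_iff by auto
  have Be: "Bseq (\<lambda>k. e i (s i k))"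
    by (rule BfunI[where K = C], rule eventually_M) (rule C[OF activated(1)[OF _ i]])
  define a where "a k = G i (z (l i k)) + q k *\<^sub>R w i (l i k) + e i (s i k)" for k
  have Ba: "Bseq a"
    unfolding a_def[abs_def] by (intro Bseq_plus Bseq_scaleR Bseq_G_z_lag Bseq_w_lag Bq Be i)
  have ya: "q k *\<^sub>R y i k = a k - x i k" if "k \<ge> M" for k
    using backward_props(2)[OF exec_M[OF that] i activated(1)[OF that i] True]
    unfolding a_def q_def by (simp add: algebra_simps)
  \<comment> \<open>A point of the graph taken from a solution: \<open>p\<close> is the resolvent
    value at \<open>p + q k *\<^sub>R p'\<close> for every stepsize \<open>q k\<close>, which makes
    it a reference point independent of \<open>k\<close>.\<close>
  define p p' where "p = G i (solution 0)" and "p' = dual solution i"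
  have pp: "p \<in> H i" "p' \<in> T i p"
    unfolding p_def p'_def using solution_props G_mem i by auto
  have "norm (x i k - p) \<le> norm (a k - p - q k *\<^sub>R p')" if k: "k \<ge> M" for k
  proof -
    have "0 \<le> inner (x i k - p) (y i k - p')"
      by (rule T_monotone[OF i x_mem[OF exec_M[OF k] i] y_in_T[OF exec_M[OF k] i activated(1)[OF k i]] pp])
    then have "0 \<le> q k * inner (x i k - p) (y i k - p')"
      using q[OF k] r(1) by simp
    also have "\<dots> = inner (x i k - p) (q k *\<^sub>R y i k - q k *\<^sub>R p')"
      by (simp add: inner_diff_right algebra_simps)
    also have "\<dots> = inner (x i k - p) (a k - p - q k *\<^sub>R p') - (norm (x i k - p))\<^sup>2"
      unfolding ya[OF k] power2_norm_eq_inner by (simp add: inner_diff algebra_simps)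
    finally have "(norm (x i k - p))\<^sup>2 \<le> norm (x i k - p) * norm (a k - p - q k *\<^sub>R p')"
      using norm_cauchy_schwarz[of "x i k - p" "a k - p - q k *\<^sub>R p'"] by linarith
    then show ?thesis
      by (cases "x i k = p") (simp_all add: power2_eq_square)
  qed
  moreover have "Bseq (\<lambda>k. a k - p - q k *\<^sub>R p')"
    by (intro Bseq_minus Bseq_scaleR Ba Bq Bfun_const)
  ultimately have "Bseq (\<lambda>k. x i k - p)"
    by (rule Bseq_eventually_mono[OF eventually_M])
  from Bseq_plus[OF this Bfun_const[of p]] have Bx: "Bseq (x i)" by simp
  have "Bseq (y i)"
  proof (rule Bseq_eventually_eq[OF eventually_M])
    show "Bseq (\<lambda>k. inverse (q k) *\<^sub>R (a k - x i k))"
      by (intro Bseq_scaleR Bseq_minus Bq' Ba Bx)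
    show "y i k = inverse (q k) *\<^sub>R (a k - x i k)" if "k \<ge> M" for k
      unfolding ya[OF that, symmetric] using q[OF that] r(1) by simp
  qed
  with Bx show ?thesis by blast
next
  case False
  then have F: "i \<in> IF" using i IF_IB by blast
  obtain r where r: "r > 0" "\<forall>\<^sub>F k in sequentially. \<rho> i (l i k) \<le> r"
    by (metis \<rho>_forward[OF F])
  have Bq: "Bseq (\<lambda>k. \<rho> i (l i k))"
  proof (rule BfunI[where K = r])
    show "\<forall>\<^sub>F k in sequentially. norm (\<rho> i (l i k)) \<le> r"
      using r(2) eventually_ge_at_top[of M]
    proof eventually_elim
      case (elim k)
      then show ?case using \<rho>_pos[OF i lag(1)[OF elim(2) i]] by simp
    qed
  qed
  have Gz_mem: "\<forall>\<^sub>F k in sequentially. G i (z (l i k)) \<in> H i"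
    using z_lag_mem[OF i] by eventually_elim (rule G_mem[OF i])
  have Bx: "Bseq (x i)"
  proof (rule Bseq_eventually_eq[OF eventually_M])
    show "Bseq (\<lambda>k. G i (z (l i k)) - \<rho> i (l i k) *\<^sub>R (F i (G i (z (l i k))) - w i (l i k)))"
      by (intro Bseq_scaleR Bseq_minus Bq Bseq_F[OF F] Bseq_G_z_lag Bseq_w_lag i Gz_mem)
    show "x i k = G i (z (l i k)) - \<rho> i (l i k) *\<^sub>R (F i (G i (z (l i k))) - w i (l i k))" if "k \<ge> M" for k
      by (rule forward_props(2)[OF exec_M[OF that] i activated(1)[OF that i] F])
  qed
  have "Bseq (y i)"
  proof (rule Bseq_eventually_eq[OF eventually_M])
    show "Bseq (\<lambda>k. F i (x i k))"
      by (intro Bseq_F[OF F] Bx eventually_M x_mem exec_M i)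
    show "y i k = F i (x i k)" if "k \<ge> M" for k
      by (rule forward_props(1)[OF exec_M[OF that] i activated(1)[OF that i] F])
  qed
  with Bx show ?thesis by blast
qed

lemma Bseq_x: "i \<in> {1..n} \<Longrightarrow> Bseq (x i)" and Bseq_y: "i \<in> {1..n} \<Longrightarrow> Bseq (y i)"
  using Bseq_xy by blast+

section \<open>Vanishing separator values and increments\<close>

lemma \<pi>_upper: obtains C where "\<And>k. k \<ge> M \<Longrightarrow> \<pi> k \<le> C"
proof -
  have n: "n \<in> {1..n}" using n_pos by simp
  have Bu: "Bseq (\<lambda>k. u i k)" if "i \<in> {1..<n}" for i
    unfolding resid_u_def using that x_n_mem exec_M
    by (intro Bseq_minus Bseq_x Bseq_G[OF _ Bseq_x[OF n]] eventually_M) auto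
  have Bv: "Bseq v"
    unfolding resid_v_def
    by (intro Bseq_plus Bseq_finite_sum Bseq_y n Bseq_bounded_linear[OF bounded_linear_adj]) auto
  have sq: "Bseq (\<lambda>k. (norm (f k))\<^sup>2)" if "Bseq f" for f :: "nat \<Rightarrow> 'a"
  proof -
    from that obtain K where "\<And>k. norm (f k) \<le> K" unfolding Bseq_def by blast
    then have "norm ((norm (f k))\<^sup>2) \<le> K\<^sup>2" for k by (simp add: power_mono)
    then show ?thesis by (rule BseqI')
  qed
  have "Bseq \<pi>"
    unfolding grad_norm2_def
    using Bseq_scaleR[OF Bfun_const sq[OF Bv], of "inverse \<gamma>"]
    by (intro Bseq_plus Bseq_finite_sum sq Bu) simp_all
  then obtain C where "\<And>k. norm (\<pi> k) \<le> C" unfolding Bseq_def by blast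
  then show thesis using that[of C] by (simp add: abs_le_iff)
qed

text \<open>The square is \<open>\<pi> k * progress k\<close>, a bounded factor times a vanishing
  one.\<close>

lemma max_\<phi>_tendsto_zero: "(\<lambda>k. max 0 (\<phi> k)) \<longlonglongrightarrow> 0"
proof -
  obtain C where C: "\<And>k. k \<ge> M \<Longrightarrow> \<pi> k \<le> C" by (metis \<pi>_upper)
  show ?thesis
  proof (rule tendsto_zero_of_power2_le[OF eventually_M progress_tendsto_zero])
    fix k assume "k \<ge> M"
    then have "(max 0 (\<phi> k))\<^sup>2 = \<pi> k * progress k"
      using \<pi>_pos[of k] by (simp add: progress_def)
    also have "\<dots> \<le> C * progress k"
      by (intro mult_right_mono C \<open>k \<ge> M\<close> progress_nonneg)
    finally show "(norm (max 0 (\<phi> k)))\<^sup>2 \<le> C * progress k" by simp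
  qed
qed

text \<open>The left side is the squared length of the whole update in the weighted norm; the factor
  \<open>4\<close> comes from \<open>\<beta> k < 2\<close>.\<close>

lemma \<alpha>_progress: "k \<ge> M \<Longrightarrow> (\<alpha> k)\<^sup>2 * \<pi> k \<le> 4 * progress k"
proof -
  assume k: "k \<ge> M"
  have "(\<beta> k)\<^sup>2 \<le> 2\<^sup>2"
    using \<beta>_range[of k] \<beta>_lo_pos \<beta>_hi_less k M_pos by (intro power_mono) auto
  then show ?thesis
    unfolding \<alpha>_identities(2)[OF k] by (intro mult_right_mono progress_nonneg) simp
qed

lemma z_step_tendsto_zero: "(\<lambda>k. z (Suc k) - z k) \<longlonglongrightarrow> 0"
proof (rule tendsto_zero_of_power2_le[OF eventually_M progress_tendsto_zero])
  fix k assume k: "k \<ge> M"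
  then have "1 \<le> k" using M_pos by simp
  have "(norm (z (Suc k) - z k))\<^sup>2 = inverse \<gamma> * ((\<alpha> k)\<^sup>2 * (inverse \<gamma> * (norm (v k))\<^sup>2))"
    unfolding projection_step(1)[OF exec[OF \<open>1 \<le> k\<close>] no_ret[OF \<open>1 \<le> k\<close>]]
    by (simp add: power_mult_distrib power2_eq_square)
  also have "\<dots> \<le> inverse \<gamma> * ((\<alpha> k)\<^sup>2 * \<pi> k)"
    using \<gamma>_pos by (intro mult_left_mono) (simp_all add: grad_norm2_def sum_nonneg)
  also have "\<dots> \<le> inverse \<gamma> * (4 * progress k)"
    using \<gamma>_pos by (intro mult_left_mono \<alpha>_progress k) simp
  finally show "(norm (z (Suc k) - z k))\<^sup>2 \<le> (inverse \<gamma> * 4) * progress k" by simp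
qed

lemma w_step_tendsto_zero:
  assumes "i \<in> {1..n}"
  shows "(\<lambda>k. w i (Suc k) - w i k) \<longlonglongrightarrow> 0"
proof -
  have less: "(\<lambda>k. w i (Suc k) - w i k) \<longlonglongrightarrow> 0" if i: "i \<in> {1..<n}" for i
  proof (rule tendsto_zero_of_power2_le[OF eventually_M progress_tendsto_zero])
    fix k assume k: "k \<ge> M"
    then have "1 \<le> k" using M_pos by simp
    have "(norm (w i (Suc k) - w i k))\<^sup>2 = (\<alpha> k)\<^sup>2 * (norm (u i k))\<^sup>2"
      unfolding projection_step(2)[OF exec[OF \<open>1 \<le> k\<close>] no_ret[OF \<open>1 \<le> k\<close>] i]
      by (simp add: power_mult_distrib)
    also have "\<dots> \<le> (\<alpha> k)\<^sup>2 * \<pi> k"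
    proof (rule mult_left_mono)
      have "(norm (u i k))\<^sup>2 \<le> (\<Sum>i\<in>{1..<n}. (norm (u i k))\<^sup>2)"
        using i by (intro member_le_sum) auto
      then show "(norm (u i k))\<^sup>2 \<le> \<pi> k"
        unfolding grad_norm2_def using \<gamma>_pos by (simp add: add_increasing2)
    qed simp
    also have "\<dots> \<le> 4 * progress k" by (rule \<alpha>_progress[OF k])
    finally show "(norm (w i (Suc k) - w i k))\<^sup>2 \<le> 4 * progress k" .
  qed
  show ?thesis
  proof (cases "i = n")
    case True
    have "(\<lambda>k. - (\<Sum>j\<in>{1..<n}. adj j (w j (Suc k) - w j k))) \<longlonglongrightarrow> - (\<Sum>j\<in>{1..<n}. 0)"
      by (intro tendsto_intros bounded_linear.tendsto_zero[OF bounded_linear_adj] less) auto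
    moreover have "\<forall>\<^sub>F k in sequentially.
        - (\<Sum>j\<in>{1..<n}. adj j (w j (Suc k) - w j k)) = w n (Suc k) - w n k"
      using exec_eventually
    proof eventually_elim
      case (elim k)
      have "exec (Suc k)" by (rule exec) simp
      moreover have "adj j (w j (Suc k) - w j k) = adj j (w j (Suc k)) - adj j (w j k)" if "j \<in> {1..<n}" for j
        using bounded_linear.linear[OF bounded_linear_adj, of j] that by (simp add: linear_diff)
      ultimately show ?case
        using elim by (simp add: w_n_eq sum_subtractf)
    qed
    ultimately show ?thesis unfolding True by (simp add: Lim_transform_eventually)
  qed (use less assms in auto)
qed

lemma z_lag_tendsto_zero: "i \<in> {1..n} \<Longrightarrow> (\<lambda>k. z k - z (l i k)) \<longlonglongrightarrow> 0"
  by (rule lagged_diff_tendsto_zero[OF z_step_tendsto_zero lag_eventually])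

lemma w_lag_tendsto_zero: "i \<in> {1..n} \<Longrightarrow> (\<lambda>k. w i k - w i (l i k)) \<longlonglongrightarrow> 0"
  by (rule lagged_diff_tendsto_zero[OF w_step_tendsto_zero lag_eventually])

lemma z_mem_eventually: "\<forall>\<^sub>F k in sequentially. z k \<in> H 0"
  using exec_eventually by eventually_elim (rule z_mem)

lemma G_z_lag_tendsto_zero: "i \<in> {1..n} \<Longrightarrow> (\<lambda>k. G i (z k) - G i (z (l i k))) \<longlonglongrightarrow> 0"
  by (rule tendsto_G_diff[OF _ z_lag_tendsto_zero z_mem_eventually z_lag_mem])

section \<open>Block gaps and strong convergence of the residuals\<close>

definition gap :: "nat \<Rightarrow> nat \<Rightarrow> real" where
  "gap i k = inner (G i (z (l i k)) - x i k) (y i k - w i (l i k))"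

text \<open>Backward blocks: in the identity \<open>\<rho> (y - w) = (G z - x) + e\<close>, pairing
  with either factor of the gap leaves one error term, and the two error conditions absorb these up
  to \<open>1 - \<sigma>\<close>. The upper stepsize bound finishes the first estimate, the lower
  one the second. Forward blocks: the second factor is the first divided by the stepsize, up to a
  Lipschitz perturbation.\<close>

lemma gap_bounds:
  assumes i: "i \<in> {1..n}"
  obtains C where "C > 0" "\<forall>\<^sub>F k in sequentially. (norm (G i (z (l i k)) - x i k))\<^sup>2 \<le> C * gap i k"
    "\<forall>\<^sub>F k in sequentially. (norm (y i k - w i (l i k)))\<^sup>2 \<le> C * gap i k"
proof -
  obtain r where r: "r > 0" "\<And>i k. i \<in> {1..n} \<Longrightarrow> k \<ge> 1 \<Longrightarrow> r \<le> \<rho> i k"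
    by (metis \<rho>_lower)
  note intro = that
  \<comment> \<open>The first estimate already makes the gap nonnegative, so both constants may be
    enlarged to their maximum.\<close>
  have *: thesis if A: "A > 0" "\<forall>\<^sub>F k in sequentially. (norm (G i (z (l i k)) - x i k))\<^sup>2 \<le> A * gap i k"
    and B: "\<forall>\<^sub>F k in sequentially. (norm (y i k - w i (l i k)))\<^sup>2 \<le> B * gap i k" for A B
  proof -
    have nonneg: "\<forall>\<^sub>F k in sequentially. 0 \<le> gap i k"
      using A(2)
    proof eventually_elim
      case (elim k)
      then have "0 \<le> A * gap i k" by (rule order_trans[rotated]) simp
      then show ?case using A(1) by (simp add: zero_le_mult_iff)
    qed
    have "\<forall>\<^sub>F k in sequentially. (norm (G i (z (l i k)) - x i k))\<^sup>2 \<le> max A B * gap i k"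
      using A(2) nonneg by eventually_elim (meson max.cobounded1 mult_right_mono order_trans)
    moreover have "\<forall>\<^sub>F k in sequentially. (norm (y i k - w i (l i k)))\<^sup>2 \<le> max A B * gap i k"
      using B nonneg by eventually_elim (meson max.cobounded2 mult_right_mono order_trans)
    ultimately show thesis using intro[of "max A B"] A(1) by simp
  qed
  show thesis
  proof (cases "i \<in> IB")
    case True
    obtain R where R: "R > 0" "\<And>i k. i \<in> IB \<Longrightarrow> k \<ge> 1 \<Longrightarrow> \<rho> i k \<le> R"
      by (metis \<rho>_upper)
    have both: "(1 - \<sigma>) * (norm (G i (z (l i k)) - x i k))\<^sup>2 \<le> \<rho> i (l i k) * gap i k"
      "\<rho> i (l i k) * (1 - \<sigma>) * (norm (y i k - w i (l i k)))\<^sup>2 \<le> gap i k" if k: "k \<ge> M" for k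
    proof -
      let ?a = "G i (z (l i k)) - x i k" and ?b = "y i k - w i (l i k)" and ?e = "e i (s i k)"
      note act = exec_M[OF k] activated(1)[OF k i]
      have eq: "\<rho> i (l i k) *\<^sub>R ?b = ?a + ?e"
        by (rule backward_props(2)[OF act(1) i act(2) True])
      have "\<rho> i (l i k) * gap i k = inner ?a (\<rho> i (l i k) *\<^sub>R ?b)"
        by (simp add: gap_def)
      also have "\<dots> = (norm ?a)\<^sup>2 + inner ?a ?e"
        unfolding eq by (simp add: inner_add_right power2_norm_eq_inner)
      also have "\<dots> \<ge> (1 - \<sigma>) * (norm ?a)\<^sup>2"
        using e_x[OF True act] by (simp add: algebra_simps)
      finally show "(1 - \<sigma>) * (norm ?a)\<^sup>2 \<le> \<rho> i (l i k) * gap i k" .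
      have "?a = \<rho> i (l i k) *\<^sub>R ?b - ?e"
        unfolding eq by simp
      then have "gap i k = inner (\<rho> i (l i k) *\<^sub>R ?b - ?e) ?b"
        unfolding gap_def by (rule arg_cong)
      also have "\<dots> = \<rho> i (l i k) * (norm ?b)\<^sup>2 - inner ?e ?b"
        by (simp only: inner_diff_left inner_scaleR_left power2_norm_eq_inner)
      also have "\<dots> \<ge> \<rho> i (l i k) * (1 - \<sigma>) * (norm ?b)\<^sup>2"
        using e_y[OF True act] by (simp add: algebra_simps)
      finally show "\<rho> i (l i k) * (1 - \<sigma>) * (norm ?b)\<^sup>2 \<le> gap i k" .
    qed
    have \<rho>_bounds: "r \<le> \<rho> i (l i k)" "\<rho> i (l i k) \<le> R" if "k \<ge> M" for k
      using r(2)[OF i] R(2)[OF True] lag(1)[OF that i] by simp_all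
    have gap_nonneg: "0 \<le> gap i k" if k: "k \<ge> M" for k
    proof -
      have "0 \<le> \<rho> i (l i k) * (1 - \<sigma>) * (norm (y i k - w i (l i k)))\<^sup>2"
        using \<rho>_bounds[OF k] r(1) \<sigma>_less by (intro mult_nonneg_nonneg) auto
      then show ?thesis using both(2)[OF k] by linarith
    qed
    show thesis
    proof (rule *[of "R / (1 - \<sigma>)" "1 / (r * (1 - \<sigma>))"])
      show "R / (1 - \<sigma>) > 0" using R(1) \<sigma>_less by simp
      have "(1 - \<sigma>) * (norm (G i (z (l i k)) - x i k))\<^sup>2 \<le> R * gap i k" if k: "k \<ge> M" for k
        using both(1)[OF k] mult_right_mono[OF \<rho>_bounds(2)[OF k] gap_nonneg[OF k]] by linarith
      then show "\<forall>\<^sub>F k in sequentially. (norm (G i (z (l i k)) - x i k))\<^sup>2 \<le> R / (1 - \<sigma>) * gap i k"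
        using \<sigma>_less by (intro eventually_M) (simp add: field_simps)
      have "r * (1 - \<sigma>) * (norm (y i k - w i (l i k)))\<^sup>2 \<le> gap i k" if k: "k \<ge> M" for k
      proof -
        have "r * (1 - \<sigma>) * (norm (y i k - w i (l i k)))\<^sup>2
            \<le> \<rho> i (l i k) * (1 - \<sigma>) * (norm (y i k - w i (l i k)))\<^sup>2"
          using \<rho>_bounds(1)[OF k] \<sigma>_less by (intro mult_right_mono) auto
        then show ?thesis using both(2)[OF k] by linarith
      qed
      then show "\<forall>\<^sub>F k in sequentially. (norm (y i k - w i (l i k)))\<^sup>2 \<le> 1 / (r * (1 - \<sigma>)) * gap i k"
        using \<sigma>_less r(1) by (intro eventually_M) (simp add: pos_le_divide_eq mult.commute)
    qed
  next
    case False
    then have F: "i \<in> IF" using i IF_IB by blast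
    obtain R where R: "R > 0" "R * L i < 1" "\<forall>\<^sub>F k in sequentially. \<rho> i (l i k) \<le> R"
      by (metis \<rho>_forward[OF F])
    have L: "L i \<ge> 0" using T_lipschitz[OF F] by (rule lipschitz_on_nonneg)
    \<comment> \<open>Coercivity constant: strong monotonicity \<open>inverse R\<close> gained from
      the step, minus the Lipschitz loss.\<close>
    define c where "c = inverse R - L i"
    have c: "c > 0" using R(1,2) by (simp add: c_def field_simps)
    \<comment> \<open>Bounds the second factor of the gap by the first: Lipschitz part plus the
      largest inverse stepsize.\<close>
    define K where "K = L i + inverse r"
    have ev: "\<forall>\<^sub>F k in sequentially. c * (norm (G i (z (l i k)) - x i k))\<^sup>2 \<le> gap i k \<and>
        norm (y i k - w i (l i k)) \<le> K * norm (G i (z (l i k)) - x i k)"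
      using R(3) eventually_ge_at_top[of M]
    proof eventually_elim
      case (elim k)
      note k = elim(2)
      let ?g = "G i (z (l i k))" and ?q = "\<rho> i (l i k)"
      let ?a = "?g - x i k"
      note act = exec_M[OF k] activated(1)[OF k i]
      have q: "r \<le> ?q" "0 < ?q" "?q \<le> R" using r(2)[OF i lag(1)[OF k i]] r(1) elim by auto
      have g_mem: "?g \<in> H i" using G_mem[OF i z_mem[OF exec[OF lag(1)[OF k i]]]] .
      have y: "y i k = F i (x i k)" by (rule forward_props(1)[OF act(1) i act(2) F])
      have "?a = ?q *\<^sub>R (F i ?g - w i (l i k))"
        using forward_props(2)[OF act(1) i act(2) F] by simp
      then have wl: "F i ?g - w i (l i k) = inverse ?q *\<^sub>R ?a"
        using q(2) by simp
      have lip: "norm (F i (x i k) - F i ?g) \<le> L i * norm ?a"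
        using lipschitz_onD[OF T_lipschitz[OF F] x_mem[OF act(1) i] g_mem]
        by (simp add: dist_norm norm_minus_commute)
      have split: "y i k - w i (l i k) = (F i (x i k) - F i ?g) + inverse ?q *\<^sub>R ?a"
        unfolding y wl[symmetric] by simp
      have "gap i k = inner ?a (F i (x i k) - F i ?g) + inverse ?q * (norm ?a)\<^sup>2"
        unfolding gap_def split by (simp add: inner_add_right power2_norm_eq_inner)
      moreover have "- inner ?a (F i (x i k) - F i ?g) \<le> norm ?a * (L i * norm ?a)"
      proof -
        have "\<bar>inner ?a (F i (x i k) - F i ?g)\<bar> \<le> norm ?a * norm (F i (x i k) - F i ?g)"
          by (rule Cauchy_Schwarz_ineq2)
        also have "\<dots> \<le> norm ?a * (L i * norm ?a)"
          by (intro mult_left_mono lip) simp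
        finally show ?thesis by simp
      qed
      moreover have "inverse R * (norm ?a)\<^sup>2 \<le> inverse ?q * (norm ?a)\<^sup>2"
        using q by (intro mult_right_mono le_imp_inverse_le) auto
      ultimately have "c * (norm ?a)\<^sup>2 \<le> gap i k"
        unfolding c_def by (simp add: left_diff_distrib power2_eq_square mult_ac)
      moreover have "norm (y i k - w i (l i k)) \<le> K * norm ?a"
      proof -
        have "norm (y i k - w i (l i k)) \<le> L i * norm ?a + inverse ?q * norm ?a"
          unfolding split by (rule order_trans[OF norm_triangle_ineq]) (use lip q(2) in simp)
        also have "\<dots> \<le> L i * norm ?a + inverse r * norm ?a"
          using q(1) r(1) by (intro add_left_mono mult_right_mono le_imp_inverse_le) auto
        finally show ?thesis by (simp add: K_def distrib_right)
      qed
      ultimately show ?case by blast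
    qed
    show thesis
    proof (rule *[of "inverse c" "K\<^sup>2 * inverse c"])
      show "inverse c > 0" using c by simp
      show first: "\<forall>\<^sub>F k in sequentially. (norm (G i (z (l i k)) - x i k))\<^sup>2 \<le> inverse c * gap i k"
        using ev by eventually_elim (use c in \<open>simp add: field_simps\<close>)
      show "\<forall>\<^sub>F k in sequentially. (norm (y i k - w i (l i k)))\<^sup>2 \<le> K\<^sup>2 * inverse c * gap i k"
        using ev first
      proof eventually_elim
        case (elim k)
        have "(norm (y i k - w i (l i k)))\<^sup>2 \<le> (K * norm (G i (z (l i k)) - x i k))\<^sup>2"
          using elim(1) by (intro power_mono) auto
        also have "\<dots> = K\<^sup>2 * (norm (G i (z (l i k)) - x i k))\<^sup>2"
          by (simp add: power_mult_distrib)
        also have "\<dots> \<le> K\<^sup>2 * (inverse c * gap i k)"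
          by (intro mult_left_mono elim(2)) simp
        finally show ?case by (simp add: mult.assoc)
      qed
    qed
  qed
qed

text \<open>
  The sum of the gaps is asymptotically at most \<^term>\<open>max 0 (\<phi> k)\<close>, and each gap is eventually
  nonnegative, so every gap vanishes.
\<close>

lemma gap_tendsto_zero:
  assumes i: "i \<in> {1..n}"
  shows "gap i \<longlonglongrightarrow> 0"
proof -
  have diff: "(\<lambda>k. gap j k - inner (G j (z k) - x j k) (y j k - w j k)) \<longlonglongrightarrow> 0" if j: "j \<in> {1..n}" for j
  proof -
    \<comment> \<open>Moving the lag out of each factor in turn leaves two products, each of a
      vanishing increment with a bounded factor.\<close>
    have "(\<lambda>k. inner (G j (z (l j k)) - x j k) (w j k - w j (l j k))
        - inner (G j (z k) - G j (z (l j k))) (y j k - w j k)) \<longlonglongrightarrow> 0 - 0"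
      by (intro tendsto_diff tendsto_inner_zero_left tendsto_inner_zero_right w_lag_tendsto_zero
          G_z_lag_tendsto_zero Bseq_minus Bseq_G_z_lag Bseq_x Bseq_y Bseq_w j)
    then show ?thesis
      by (simp add: gap_def inner_diff algebra_simps)
  qed
  have "(\<lambda>k. \<Sum>j\<in>{1..n}. gap j k - inner (G j (z k) - x j k) (y j k - w j k)) \<longlonglongrightarrow> (\<Sum>j\<in>{1..n}. 0)"
    by (intro tendsto_sum diff)
  from tendsto_add[OF max_\<phi>_tendsto_zero this]
  have upper: "(\<lambda>k. max 0 (\<phi> k) + (\<Sum>j\<in>{1..n}. gap j k - inner (G j (z k) - x j k) (y j k - w j k))) \<longlonglongrightarrow> 0"
    by simp
  have "\<forall>\<^sub>F k in sequentially. 0 \<le> gap j k" if j: "j \<in> {1..n}" for j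
  proof -
    obtain C where "C > 0" "\<forall>\<^sub>F k in sequentially. (norm (G j (z (l j k)) - x j k))\<^sup>2 \<le> C * gap j k"
      using gap_bounds[OF j] by metis
    from this(2) show ?thesis
      by eventually_elim (use \<open>C > 0\<close> in \<open>metis order_trans zero_le_mult_iff zero_le_power2 not_le less_le_trans\<close>)
  qed
  then have nonneg: "\<forall>\<^sub>F k in sequentially. \<forall>j\<in>{1..n}. 0 \<le> gap j k"
    by (intro eventually_ball_finite) auto
  show ?thesis
  proof (rule tendsto_sandwich[OF _ _ tendsto_const upper])
    show "\<forall>\<^sub>F k in sequentially. 0 \<le> gap i k"
      using nonneg by eventually_elim (use i in blast)
    show "\<forall>\<^sub>F k in sequentially. gap i k \<le>
        max 0 (\<phi> k) + (\<Sum>j\<in>{1..n}. gap j k - inner (G j (z k) - x j k) (y j k - w j k))"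
      using nonneg exec_eventually
    proof eventually_elim
      case (elim k)
      have "gap i k \<le> (\<Sum>j\<in>{1..n}. gap j k)"
        using i elim(1) by (intro member_le_sum) auto
      also have "\<dots> = \<phi> k + (\<Sum>j\<in>{1..n}. gap j k - inner (G j (z k) - x j k) (y j k - w j k))"
        unfolding \<phi>_eq[OF elim(2)] by (simp add: sum_subtractf)
      also have "\<dots> \<le> max 0 (\<phi> k) + (\<Sum>j\<in>{1..n}. gap j k - inner (G j (z k) - x j k) (y j k - w j k))"
        by simp
      finally show ?case .
    qed
  qed
qed

lemma x_G_z_tendsto_zero:
  assumes i: "i \<in> {1..n}"
  shows "(\<lambda>k. x i k - G i (z k)) \<longlonglongrightarrow> 0"
proof -
  obtain C where "\<forall>\<^sub>F k in sequentially. (norm (G i (z (l i k)) - x i k))\<^sup>2 \<le> C * gap i k"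
    using gap_bounds[OF i] by metis
  then have "(\<lambda>k. G i (z (l i k)) - x i k) \<longlonglongrightarrow> 0"
    by (rule tendsto_zero_of_power2_le[OF _ gap_tendsto_zero[OF i]])
  from tendsto_minus[OF tendsto_add[OF this G_z_lag_tendsto_zero[OF i]]] show ?thesis
    by simp
qed

lemma y_w_tendsto_zero:
  assumes i: "i \<in> {1..n}"
  shows "(\<lambda>k. y i k - w i k) \<longlonglongrightarrow> 0"
proof -
  obtain C where "\<forall>\<^sub>F k in sequentially. (norm (y i k - w i (l i k)))\<^sup>2 \<le> C * gap i k"
    using gap_bounds[OF i] by metis
  then have "(\<lambda>k. y i k - w i (l i k)) \<longlonglongrightarrow> 0"
    by (rule tendsto_zero_of_power2_le[OF _ gap_tendsto_zero[OF i]])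
  from tendsto_diff[OF this w_lag_tendsto_zero[OF i]] show ?thesis
    by simp
qed

text \<open>Replacing \<open>x i k\<close> by \<open>G i (z k)\<close> and \<open>y i k\<close> by
  \<open>w i k\<close> costs strongly vanishing residuals against bounded factors, and the sum of
  the replaced products is zero by orthogonality.\<close>

lemma sum_inner_xy_tendsto_zero: "(\<lambda>k. \<Sum>i\<in>{1..n}. inner (x i k) (y i k)) \<longlonglongrightarrow> 0"
proof -
  have "(\<lambda>k. \<Sum>i\<in>{1..n}. inner (x i k - G i (z k)) (y i k) + inner (G i (z k)) (y i k - w i k))
      \<longlonglongrightarrow> (\<Sum>i\<in>{1..n}. 0 + 0)"
    by (intro tendsto_sum tendsto_add tendsto_inner_zero_left tendsto_inner_zero_right
        x_G_z_tendsto_zero y_w_tendsto_zero Bseq_y Bseq_G[OF _ Bseq_z z_mem_eventually])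
  moreover have "\<forall>\<^sub>F k in sequentially.
      (\<Sum>i\<in>{1..n}. inner (x i k - G i (z k)) (y i k) + inner (G i (z k)) (y i k - w i k))
      = (\<Sum>i\<in>{1..n}. inner (x i k) (y i k))"
    using exec_eventually
  proof eventually_elim
    case (elim k)
    have "(\<Sum>i\<in>{1..n}. inner (G i (z k)) (w i k)) = 0"
      using sum_inner_G_dual[OF z_mem[OF elim], of "\<lambda>i. w i k"] unfolding dual_w[OF elim] .
    then show ?case
      by (simp add: inner_diff sum.distrib sum_subtractf)
  qed
  ultimately show ?thesis by (simp add: Lim_transform_eventually)
qed

section \<open>Weak limits and the conclusion\<close>

context
  fixes F q
  assumes F: "F \<le> sequentially"
    and q: "\<And>i. i < n \<Longrightarrow> q i \<in> H i"
    and lim: "\<And>i h. i < n \<Longrightarrow> h \<in> H i \<Longrightarrow> ((\<lambda>k. inner (point k i) h) \<longlongrightarrow> inner (q i) h) F"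
begin

text \<open>The filter serves twice: as a cluster filter inside Opial's argument, then as
  \<open>sequentially\<close> itself. The test vector \<open>h\<close> is arbitrary because
  \<open>adj i h\<close> always lies in \<open>H 0\<close>.\<close>

lemma weak_limit_x:
  assumes i: "i \<in> {1..n}"
  shows "((\<lambda>k. inner (x i k) h) \<longlongrightarrow> inner (G i (q 0)) h) F"
proof -
  have q0: "q 0 \<in> H 0" using q n_pos by simp
  have "((\<lambda>k. inner (x i k - G i (z k)) h) \<longlongrightarrow> 0) F"
    by (rule tendsto_mono[OF F tendsto_inner_zero_left[OF x_G_z_tendsto_zero[OF i] Bfun_const]])
  moreover have "((\<lambda>k. inner (z k) (adj i h)) \<longlongrightarrow> inner (q 0) (adj i h)) F"
    using lim[of 0 "adj i h"] adj_mem[OF i] n_pos by (simp add: point_def)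
  ultimately have "((\<lambda>k. inner (x i k - G i (z k)) h + inner (z k) (adj i h)) \<longlongrightarrow> 0 + inner (q 0) (adj i h)) F"
    by (rule tendsto_add)
  moreover have "\<forall>\<^sub>F k in F. inner (x i k - G i (z k)) h + inner (z k) (adj i h) = inner (x i k) h"
    using filter_leD[OF F exec_eventually]
    by eventually_elim (simp add: inner_adj[OF i] z_mem inner_diff)
  ultimately show ?thesis
    by (simp add: inner_adj[OF i q0] Lim_transform_eventually)
qed

lemma weak_limit_y:
  assumes i: "i \<in> {1..n}" and h: "h \<in> H i"
  shows "((\<lambda>k. inner (y i k) h) \<longlongrightarrow> inner (dual q i) h) F"
proof -
  have w_lim: "((\<lambda>k. inner (w i k) h) \<longlongrightarrow> inner (dual q i) h) F"
  proof (cases "i = n")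
    case True
    have h0: "h \<in> H 0" using h H_n True by simp
    have "((\<lambda>k. inner (w j k) (G j h)) \<longlongrightarrow> inner (q j) (G j h)) F" if "j \<in> {1..<n}" for j
      using lim[of j "G j h"] G_mem[of j h] h0 that by (simp add: point_def)
    then have "((\<lambda>k. - (\<Sum>j\<in>{1..<n}. inner (w j k) (G j h))) \<longlongrightarrow> - (\<Sum>j\<in>{1..<n}. inner (q j) (G j h))) F"
      by (intro tendsto_minus tendsto_sum)
    moreover have "\<forall>\<^sub>F k in F. - (\<Sum>j\<in>{1..<n}. inner (w j k) (G j h)) = inner (w n k) h"
      using filter_leD[OF F exec_eventually]
      by eventually_elim (simp add: w_n_eq inner_sum_left inner_sum_right inner_adj h0 inner_commute[of _ h] inner_commute[of _ "G _ h"])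
    ultimately have "((\<lambda>k. inner (w n k) h) \<longlongrightarrow> - (\<Sum>j\<in>{1..<n}. inner (q j) (G j h))) F"
      by (rule Lim_transform_eventually)
    moreover have "- (\<Sum>j\<in>{1..<n}. inner (q j) (G j h)) = inner (dual q n) h"
      by (simp add: dual_def inner_sum_left inner_sum_right inner_adj h0 inner_commute[of _ h] inner_commute[of _ "G _ h"])
    ultimately show ?thesis using True by simp
  next
    case False
    then show ?thesis using lim[of i h] i h by (simp add: point_def dual_def)
  qed
  have "((\<lambda>k. inner (y i k - w i k) h) \<longlongrightarrow> 0) F"
    by (rule tendsto_mono[OF F tendsto_inner_zero_left[OF y_w_tendsto_zero[OF i] Bfun_const]])
  from tendsto_add[OF this w_lim] show ?thesis
    by (simp add: inner_diff_left)
qed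

text \<open>In the summed monotonicity inequality all terms but the sum of the
  \<open>inner (x i k) (y i k)\<close> are linear in the iterates and pass to the weak limit; that
  sum tends to \<open>0\<close>, the exact value of its counterpart at the limit.\<close>

lemma weak_limit_in_kt_set:
  assumes "F \<noteq> bot"
  shows "(q 0, q) \<in> kt_set n H T G"
proof (rule kt_set_memI)
  have q0: "q 0 \<in> H 0" using q n_pos by simp
  then show "q 0 \<in> H 0" .
  show "q i \<in> H i" if "i \<in> {1..<n}" for i using q that by simp
  fix a b
  assume ab: "\<And>i. i \<in> {1..n} \<Longrightarrow> a i \<in> H i \<and> b i \<in> T i (a i)"
  have b: "b i \<in> H i" if "i \<in> {1..n}" for i
    using ab[OF that] T_subset[OF that] by blast
  have y_a: "((\<lambda>k. inner (a i) (y i k)) \<longlongrightarrow> inner (a i) (dual q i)) F" if "i \<in> {1..n}" for i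
    using weak_limit_y[OF that, of "a i"] ab[OF that] by (simp add: inner_commute)
  let ?S = "\<lambda>k. \<Sum>i\<in>{1..n}. inner (x i k - a i) (y i k - b i)"
  have "((\<lambda>k. (\<Sum>i\<in>{1..n}. inner (x i k) (y i k)) - (\<Sum>i\<in>{1..n}. inner (x i k) (b i))
        - (\<Sum>i\<in>{1..n}. inner (a i) (y i k)) + (\<Sum>i\<in>{1..n}. inner (a i) (b i))) \<longlongrightarrow>
      0 - (\<Sum>i\<in>{1..n}. inner (G i (q 0)) (b i)) - (\<Sum>i\<in>{1..n}. inner (a i) (dual q i))
        + (\<Sum>i\<in>{1..n}. inner (a i) (b i))) F"
    by (intro tendsto_add tendsto_diff tendsto_const tendsto_sum weak_limit_x y_a
        tendsto_mono[OF F sum_inner_xy_tendsto_zero])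
  moreover have "?S = (\<lambda>k. (\<Sum>i\<in>{1..n}. inner (x i k) (y i k)) - (\<Sum>i\<in>{1..n}. inner (x i k) (b i))
        - (\<Sum>i\<in>{1..n}. inner (a i) (y i k)) + (\<Sum>i\<in>{1..n}. inner (a i) (b i)))"
    by (rule ext) (simp add: inner_diff sum_subtractf)
  \<comment> \<open>Here the \<open>0\<close> is the sum of the
    \<open>inner (G i (q 0)) (dual q i)\<close>, zero by orthogonality.\<close>
  moreover have "(\<Sum>i\<in>{1..n}. inner (G i (q 0) - a i) (dual q i - b i)) =
      0 - (\<Sum>i\<in>{1..n}. inner (G i (q 0)) (b i)) - (\<Sum>i\<in>{1..n}. inner (a i) (dual q i))
        + (\<Sum>i\<in>{1..n}. inner (a i) (b i))"
  proof -
    have "(\<Sum>i\<in>{1..n}. inner (G i (q 0) - a i) (dual q i - b i)) =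
      (\<Sum>i\<in>{1..n}. inner (G i (q 0)) (dual q i))
        - (\<Sum>i\<in>{1..n}. inner (G i (q 0)) (b i)) - (\<Sum>i\<in>{1..n}. inner (a i) (dual q i))
        + (\<Sum>i\<in>{1..n}. inner (a i) (b i))"
      by (simp add: inner_diff sum_subtractf)
    then show ?thesis unfolding sum_inner_G_dual[OF q0] .
  qed
  ultimately have S_lim: "(?S \<longlongrightarrow> (\<Sum>i\<in>{1..n}. inner (G i (q 0) - a i) (dual q i - b i))) F"
    by (simp only:)
  have "\<forall>\<^sub>F k in sequentially. 0 \<le> ?S k"
  proof (rule eventually_M)
    fix k assume k: "k \<ge> M"
    show "0 \<le> ?S k"
    proof (rule sum_nonneg)
      fix i assume i: "i \<in> {1..n}"
      show "0 \<le> inner (x i k - a i) (y i k - b i)"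
        by (rule T_monotone[OF i x_mem[OF exec_M[OF k] i] y_in_T[OF exec_M[OF k] i activated(1)[OF k i]]
              conjunct1[OF ab[OF i]] conjunct2[OF ab[OF i]]])
    qed
  qed
  from tendsto_lowerbound[OF S_lim filter_leD[OF F this] assms]
  show "0 \<le> (\<Sum>i\<in>{1..n}. inner (G i (q 0) - a i) (dual q i - b i))" .
qed

end

lemma weak_convergence:
  "\<exists>z_bar w_bar. (z_bar, w_bar) \<in> kt_set n H T G
    \<and> weakly_converges (product_space n H) (product_inner n) (\<lambda>k. (z k, \<lambda>i. w i k)) (z_bar, w_bar)
    \<and> (\<forall>i\<in>{1..<n}. weakly_converges (H i) inner (x i) (G i z_bar)
         \<and> weakly_converges (H i) inner (y i) (w_bar i))
    \<and> weakly_converges (H 0) inner (x n) z_bar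
    \<and> weakly_converges (H 0) inner (y n) (- (\<Sum>i\<in>{1..<n}. adj i (w_bar i)))"
proof -
  let ?S = "{p. (p 0, p) \<in> kt_set n H T G}"
  obtain q where qS: "q \<in> ?S" and q: "\<And>i. i \<in> {..<n} \<Longrightarrow> q i \<in> H i"
    and lim: "\<And>i h. i \<in> {..<n} \<Longrightarrow> h \<in> H i \<Longrightarrow> (\<lambda>k. inner (point k i) h) \<longlonglongrightarrow> inner (q i) h"
  proof (rule opial_weak_convergence[of "{..<n}" weight H ?S point])
    show "?S \<noteq> {}" using solution by blast
    show "convergent (\<lambda>k. \<Sum>i<n. weight i * (norm (point k i - p i))\<^sup>2)" if "p \<in> ?S" for p
      using dist2_convergent(1)[of p] that by (simp add: dist2_def[abs_def])
    show "p \<in> ?S"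
      if "F \<le> sequentially" "F \<noteq> bot" "\<And>i. i \<in> {..<n} \<Longrightarrow> p i \<in> H i"
        "\<And>i h. i \<in> {..<n} \<Longrightarrow> h \<in> H i \<Longrightarrow> ((\<lambda>k. inner (point k i) h) \<longlongrightarrow> inner (p i) h) F" for F p
      using weak_limit_in_kt_set[of F p] that by simp
  qed (use weight_pos H_hilbert in auto)
  have kt: "(q 0, q) \<in> kt_set n H T G" using qS by simp
  have q': "\<And>i. i < n \<Longrightarrow> q i \<in> H i" using q by simp
  have lim': "\<And>i h. i < n \<Longrightarrow> h \<in> H i \<Longrightarrow> (\<lambda>k. inner (point k i) h) \<longlonglongrightarrow> inner (q i) h"
    using lim by simp
  \<comment> \<open>With \<open>sequentially\<close> as the filter, the cluster statements become
    convergence of the full sequences.\<close>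
  have weak_x: "(\<lambda>k. inner (x i k) h) \<longlonglongrightarrow> inner (G i (q 0)) h" if "i \<in> {1..n}" for i h
    by (rule weak_limit_x[OF order_refl]) (use q' lim' that in auto)
  have weak_y: "(\<lambda>k. inner (y i k) h) \<longlonglongrightarrow> inner (dual q i) h" if "i \<in> {1..n}" "h \<in> H i" for i h
    by (rule weak_limit_y[OF order_refl]) (use q' lim' that in auto)
  have n: "n \<in> {1..n}" using n_pos by simp
  have q0: "q 0 \<in> H 0" using q' n_pos by simp
  have "weakly_converges (product_space n H) (product_inner n) (\<lambda>k. (z k, \<lambda>i. w i k)) (q 0, q)"
    unfolding weakly_converges_def
  proof (intro conjI ballI)
    show "(q 0, q) \<in> product_space n H"
      using q0 q' by (auto simp: product_space_def)
    fix h assume "h \<in> product_space n H"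
    then have h: "fst h \<in> H 0" "\<And>i. i \<in> {1..<n} \<Longrightarrow> snd h i \<in> H i"
      by (auto simp: product_space_def)
    have "(\<lambda>k. inner (point k 0) (fst h) + (\<Sum>i\<in>{1..<n}. inner (point k i) (snd h i)))
        \<longlonglongrightarrow> inner (q 0) (fst h) + (\<Sum>i\<in>{1..<n}. inner (q i) (snd h i))"
      using n_pos by (intro tendsto_add tendsto_sum lim' h) auto
    then show "(\<lambda>k. product_inner n (z k, \<lambda>i. w i k) h) \<longlonglongrightarrow> product_inner n (q 0, q) h"
      by (simp add: product_inner_def point_def)
  qed
  moreover have "weakly_converges (H i) inner (x i) (G i (q 0))" if "i \<in> {1..n}" for i
    unfolding weakly_converges_def using weak_x[OF that] G_mem[OF that q0] by simp
  moreover have "weakly_converges (H i) inner (y i) (dual q i)" if "i \<in> {1..n}" for i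
    unfolding weakly_converges_def using weak_y[OF that] dual_mem[OF q' that] by simp
  moreover have "G n (q 0) = q 0" "dual q n = - (\<Sum>i\<in>{1..<n}. adj i (q i))"
    using G_n[OF q0] by (simp_all add: dual_def)
  ultimately show ?thesis
    using kt n H_n by (intro exI[of _ "q 0"] exI[of _ q]) (metis atLeastAtMost_iff atLeastLessThan_iff dual_less less_imp_le)
qed

end

theorem theorem1:
  fixes H :: "nat \<Rightarrow> 'a::real_inner set"
    and T :: "nat \<Rightarrow> 'a \<Rightarrow> 'a set"
    and G :: "nat \<Rightarrow> 'a \<Rightarrow> 'a"
    and L :: "nat \<Rightarrow> real"
    and n M D :: nat
    and IF IB :: "nat set"
    and I :: "nat \<Rightarrow> nat set"
    and d :: "nat \<Rightarrow> nat \<Rightarrow> nat"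
    and \<rho> :: "nat \<Rightarrow> nat \<Rightarrow> real"
    and \<beta> :: "nat \<Rightarrow> real"
    and \<beta>_lo \<beta>_hi \<gamma> \<sigma> :: real
    and e x y w :: "nat \<Rightarrow> nat \<Rightarrow> 'a"
    and z :: "nat \<Rightarrow> 'a"
  \<comment> \<open>(A1)\<close>
  assumes "n \<ge> 1"
    and "\<And>i. i < n \<Longrightarrow> hilbert_subspace (H i)"
    and "H n = H 0"
    and "IF \<union> IB = {1..n}" and "IF \<inter> IB = {}"
    and "\<And>i. i \<in> {1..n} \<Longrightarrow> monotone_operator (H i) (T i)"
    and "\<And>i v. i \<in> IF \<Longrightarrow> v \<in> H i \<Longrightarrow> is_singleton (T i v)"
    and "\<And>i. i \<in> IF \<Longrightarrow> (L i)-lipschitz_on (H i) (\<lambda>v. the_elem (T i v))"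
    and "\<And>i. i \<in> IB \<Longrightarrow> maximal_monotone_operator (H i) (T i)"
    and "\<And>i. i \<in> {1..<n} \<Longrightarrow> bounded_linear_between (H 0) (H i) (G i)"
    and "\<And>v. v \<in> H 0 \<Longrightarrow> G n v = v"
    and "kt_set n H T G \<noteq> {}"
  \<comment> \<open>parameters of the algorithm\<close>
    and "\<And>k. k \<ge> 1 \<Longrightarrow> I k \<subseteq> {1..n}"
    and "\<And>i k. i \<in> {1..n} \<Longrightarrow> k \<ge> 1 \<Longrightarrow> d i k \<in> {1..k}"
    and "\<And>i k. i \<in> {1..n} \<Longrightarrow> k \<ge> 1 \<Longrightarrow> \<rho> i k > 0"
    and "0 < \<beta>_lo" and "\<beta>_lo \<le> \<beta>_hi" and "\<beta>_hi < 2"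
    and "\<And>k. k \<ge> 1 \<Longrightarrow> \<beta> k \<in> {\<beta>_lo..\<beta>_hi}"
    and "\<gamma> > 0"
    and "\<And>i k. i \<in> IB \<Longrightarrow> k \<ge> 1 \<Longrightarrow> e i k \<in> H i"
  \<comment> \<open>the iterates\<close>
    and "projective_splitting_run n H T G IF IB I d \<rho> \<beta> \<gamma> e z w x y"
  \<comment> \<open>(A2)\<close>
    and "M \<ge> 1"
    and "\<And>j. j \<ge> 1 \<Longrightarrow> (\<Union>k\<in>{j..j + M - 1}. I k) = {1..n}"
    and "\<And>i k. k \<ge> 1 \<Longrightarrow> i \<in> I k \<Longrightarrow> k - d i k \<le> D"
  \<comment> \<open>(A3); in \<open>ereal\<close>, \<open>1 / 0 = \<infinity>\<close>\<close>
    and "(INF i\<in>{1..n}. INF k\<in>{1..}. ereal (\<rho> i k)) > 0"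
    and "(SUP i\<in>IB. SUP k\<in>{1..}. ereal (\<rho> i k)) < \<infinity>"
    and "\<And>i. i \<in> IF \<Longrightarrow> limsup (\<lambda>k. ereal (\<rho> i k)) < 1 / ereal (L i)"
  \<comment> \<open>(A4)\<close>
    and "\<And>i. i \<in> IB \<Longrightarrow> bounded (e i ` {1..})"
    and "0 \<le> \<sigma>" and "\<sigma> < 1"
    and "\<And>i k. i \<in> IB \<Longrightarrow> executed n H G I \<gamma> x y k \<Longrightarrow> last_activation I i k \<ge> 1 \<Longrightarrow>
           inner (G i (z (last_info I d i k)) - x i k) (e i (last_activation I i k))
           \<ge> - \<sigma> * (norm (G i (z (last_info I d i k)) - x i k))\<^sup>2"
    and "\<And>i k. i \<in> IB \<Longrightarrow> executed n H G I \<gamma> x y k \<Longrightarrow> last_activation I i k \<ge> 1 \<Longrightarrow>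
           inner (e i (last_activation I i k)) (y i k - w i (last_info I d i k))
           \<le> \<rho> i (last_info I d i k) * \<sigma> * (norm (y i k - w i (last_info I d i k)))\<^sup>2"
  shows "(\<forall>k. terminates_at n H G I \<gamma> x y k \<longrightarrow> (z (k + 1), \<lambda>i. w i (k + 1)) \<in> kt_set n H T G)
    \<and> ((\<nexists>k. terminates_at n H G I \<gamma> x y k) \<longrightarrow>
        (\<exists>z_bar w_bar. (z_bar, w_bar) \<in> kt_set n H T G
          \<and> weakly_converges (product_space n H) (product_inner n)
               (\<lambda>k. (z k, \<lambda>i. w i k)) (z_bar, w_bar)
          \<and> (\<forall>i\<in>{1..<n}. weakly_converges (H i) inner (x i) (G i z_bar)
               \<and> weakly_converges (H i) inner (y i) (w_bar i))
          \<and> weakly_converges (H 0) inner (x n) z_bar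
          \<and> weakly_converges (H 0) inner (y n)
               (- (\<Sum>i\<in>{1..<n}. adjoint_on (H 0) (G i) (w_bar i)))))"
proof -
  interpret projective_splitting H T G L n IF IB M D I d \<rho> \<beta> \<beta>_lo \<beta>_hi \<gamma> \<sigma> e x y w z
    by unfold_locales (fact assms)+
  show ?thesis
  proof (intro conjI allI impI)
    show "(z (k + 1), \<lambda>i. w i (k + 1)) \<in> kt_set n H T G" if "terminates_at n H G I \<gamma> x y k" for k
      by (rule return_in_kt_set[OF that])
  next
    assume "\<nexists>k. terminates_at n H G I \<gamma> x y k"
    then interpret nonterminating_splitting H T G L n IF IB M D I d \<rho> \<beta> \<beta>_lo \<beta>_hi \<gamma> \<sigma> e x y w z
      by unfold_locales
    show "\<exists>z_bar w_bar. (z_bar, w_bar) \<in> kt_set n H T G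
          \<and> weakly_converges (product_space n H) (product_inner n)
               (\<lambda>k. (z k, \<lambda>i. w i k)) (z_bar, w_bar)
          \<and> (\<forall>i\<in>{1..<n}. weakly_converges (H i) inner (x i) (G i z_bar)
               \<and> weakly_converges (H i) inner (y i) (w_bar i))
          \<and> weakly_converges (H 0) inner (x n) z_bar
          \<and> weakly_converges (H 0) inner (y n)
               (- (\<Sum>i\<in>{1..<n}. adjoint_on (H 0) (G i) (w_bar i)))"
      by (rule weak_convergence)
  qed
qed

end
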